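(* Let $(X,\mathcal{M},\mu)$ be a $\sigma$-finite measure space and $\Phi$ an $N^*$-function for which there is a constant $k\ge2$ with $\Phi(kx)=2\Phi(x)$ for all $x>0$. A functional $U$ on $L_\Phi(X)$ is continuous and linear if and only if either (a) $\Lambda=\emptyset$ and $U\equiv0$, or (b) $\Lambda\ne\emptyset$ and $U(f)=\sum_iu_i\overline f_i$ with $\|U\|=\sup_i|u_i|\,\Phi^{-1}(1/a_i)<\infty$, where $\{A_i\}$ is a finite or countable family of pairwise disjoint atoms such that every atom coincides up to a $\mu$-null set with exactly one $A_i$, $a_i=\mu(A_i)$, and $\overline f_i$ is the a.e. constant value of $f$ on $A_i$.
   Context: An $N^*$-function is a function $\Phi:\mathbb{R}\to\mathbb{R}$ of the form $\Phi(x)=\int_0^{|x|}p(t)\,dt<+\infty$ for all $x$, where $p:[0,\infty)\to[0,\infty]$ is right-continuous, positive on $(0,\infty)$, non-increasing, and satisfies $\lim_{t\to0^+}p(t)=+\infty$ and $\lim_{t\to+\infty}p(t)=0$. $\Phi^{-1}$ is the inverse of $\Phi|_{[0,\infty)}$. $L_\Phi(X)$ is the space of (classes modulo a.e. equality of) measurable $f$ with $\int_X\Phi(f)\,d\mu<\infty$, with quasi-norm $\|f\|_\Phi=\inf\{\lambda>0:\int_X\Phi(|f|/\lambda)\,d\mu\le1\}$; for a linear functional $U$, $\|U\|=\sup\{|U(f)|:\|f\|_\Phi\le1\}$. An atom is a set $A\in\mathcal{M}$ with $\mu(A)>0$ such that every measurable $B\subset A$ with $\mu(B)<\mu(A)$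 has $\mu(B)=0$; $\Lambda$ denotes the collection of atoms. *)

theory Defs
  imports "HOL-Analysis.Analysis"
begin

text \<open>N*-function: Phi x = integral of p over [0,|x|], p right-continuous, positive,
  non-increasing on (0,inf), p -> +inf at 0+, p -> 0 at +inf. The value p 0 (= +inf in
  the paper) is irrelevant for the integral and is left unconstrained.\<close>
definition Nstar_fun :: "(real \<Rightarrow> real) \<Rightarrow> bool" where
  "Nstar_fun \<Phi> \<longleftrightarrow> (\<exists>p :: real \<Rightarrow> real.
      (\<forall>t>0. p t > 0) \<and>
      (\<forall>s t. 0 < s \<and> s \<le> t \<longrightarrow> p t \<le> p s) \<and>
      (\<forall>t>0. (p \<longlongrightarrow> p t) (at_right t)) \<and>
      filterlim p at_top (at_right 0) \<and>
      (p \<longlongrightarrow> 0) at_top \<and>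
      (\<forall>x. (p has_integral \<Phi> x) {0..\<bar>x\<bar>}))"

definition Phi_inv :: "(real \<Rightarrow> real) \<Rightarrow> real \<Rightarrow> real" where
  "Phi_inv \<Phi> y = (THE x. 0 \<le> x \<and> \<Phi> x = y)"

definition Orlicz_space :: "'a measure \<Rightarrow> (real \<Rightarrow> real) \<Rightarrow> ('a \<Rightarrow> real) set" where
  "Orlicz_space M \<Phi> = {f \<in> borel_measurable M. (\<integral>\<^sup>+ x. ennreal (\<Phi> (f x)) \<partial>M) < \<infinity>}"

definition Orlicz_qnorm :: "'a measure \<Rightarrow> (real \<Rightarrow> real) \<Rightarrow> ('a \<Rightarrow> real) \<Rightarrow> real" where
  "Orlicz_qnorm M \<Phi> f = Inf {r::real. r > 0 \<and> (\<integral>\<^sup>+ x. ennreal (\<Phi> (\<bar>f x\<bar> / r)) \<partial>M) \<le> 1}"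

definition is_atom :: "'a measure \<Rightarrow> 'a set \<Rightarrow> bool" where
  "is_atom M A \<longleftrightarrow> A \<in> sets M \<and> emeasure M A > 0 \<and>
     (\<forall>B \<in> sets M. B \<subseteq> A \<and> emeasure M B < emeasure M A \<longrightarrow> emeasure M B = 0)"

definition atoms :: "'a measure \<Rightarrow> 'a set set" where
  "atoms M = {A. is_atom M A}"

definition atom_enumeration :: "'a measure \<Rightarrow> nat set \<Rightarrow> (nat \<Rightarrow> 'a set) \<Rightarrow> bool" where
  "atom_enumeration M I A \<longleftrightarrow>
     (\<forall>i\<in>I. is_atom M (A i)) \<and> disjoint_family_on A I \<and>
     (\<forall>B. is_atom M B \<longrightarrow> (\<exists>!i. i \<in> I \<and> emeasure M ((B - A i) \<union> (A i - B)) = 0))"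

definition atom_value :: "'a measure \<Rightarrow> ('a \<Rightarrow> real) \<Rightarrow> 'a set \<Rightarrow> real" where
  "atom_value M f A = (THE c. AE x in M. x \<in> A \<longrightarrow> f x = c)"

definition respects_ae :: "'a measure \<Rightarrow> (real \<Rightarrow> real) \<Rightarrow> (('a \<Rightarrow> real) \<Rightarrow> real) \<Rightarrow> bool" where
  "respects_ae M \<Phi> U \<longleftrightarrow> (\<forall>f \<in> Orlicz_space M \<Phi>. \<forall>g \<in> Orlicz_space M \<Phi>.
      (AE x in M. f x = g x) \<longrightarrow> U f = U g)"

definition linear_functional :: "'a measure \<Rightarrow> (real \<Rightarrow> real) \<Rightarrow> (('a \<Rightarrow> real) \<Rightarrow> real) \<Rightarrow> bool" where
  "linear_functional M \<Phi> U \<longleftrightarrow> (\<forall>f \<in> Orlicz_space M \<Phi>. \<forall>g \<in> Orlicz_space M \<Phi>. \<forall>a b :: real.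
      U (\<lambda>x. a * f x + b * g x) = a * U f + b * U g)"

definition continuous_functional :: "'a measure \<Rightarrow> (real \<Rightarrow> real) \<Rightarrow> (('a \<Rightarrow> real) \<Rightarrow> real) \<Rightarrow> bool" where
  "continuous_functional M \<Phi> U \<longleftrightarrow> (\<forall>f \<in> Orlicz_space M \<Phi>. \<forall>\<epsilon>>0. \<exists>\<delta>>0. \<forall>g \<in> Orlicz_space M \<Phi>.
      Orlicz_qnorm M \<Phi> (\<lambda>x. g x - f x) < \<delta> \<longrightarrow> \<bar>U g - U f\<bar> < \<epsilon>)"

definition functional_norm :: "'a measure \<Rightarrow> (real \<Rightarrow> real) \<Rightarrow> (('a \<Rightarrow> real) \<Rightarrow> real) \<Rightarrow> ereal" where
  "functional_norm M \<Phi> U =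
     (SUP f \<in> {f \<in> Orlicz_space M \<Phi>. Orlicz_qnorm M \<Phi> f \<le> 1}. ereal \<bar>U f\<bar>)"

end

theory Submission
  imports Defs
begin

text \<open>Put \<open>I(f) = \<integral> \<Phi>(f) d\<mu>\<close>. A continuous linear \<open>U\<close> satisfies \<open>\<bar>U g\<bar> \<le> K\<close> on
  \<open>{I(g) \<le> 1}\<close>. The functional equation gives \<open>I(k\<^sup>n g) = 2\<^sup>n I(g)\<close>, and \<open>k > 2\<close> because
  \<open>p\<close> tends to 0 (with \<open>k = 2\<close>, \<open>\<Phi>\<close> would grow linearly). Rescaling therefore yields
  \<open>U g = o(I(g))\<close> as \<open>I(g)\<close> tends to 0. For fixed \<open>f\<close>, the set function \<open>B \<mapsto> U(f 1\<^sub>B)\<close> is thus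
  countably additive and \<open>o(\<nu>(B))\<close>, where \<open>\<nu> = \<Phi>(f) \<mu>\<close> is finite; cutting an atom-free set into
  pieces of small \<open>\<nu>\<close>-measure shows that it vanishes there, and only the atoms contribute.

  For the norm, if \<open>I(f) \<le> 1\<close> then \<open>t\<^sub>i = \<Phi>(f\<^sub>i) a\<^sub>i\<close> has \<open>\<Sum> t\<^sub>i \<le> 1\<close>, and concavity of \<open>\<Phi>\<close> gives
  \<open>\<bar>f\<^sub>i\<bar> \<le> t\<^sub>i \<Phi>\<^sup>-\<^sup>1(1/a\<^sub>i)\<close>.\<close>

subsection \<open>Concave functions with a functional equation\<close>

text \<open>What the proof retains of an N*-function. \<open>Phi_ray\<close> is concavity on
  segments starting at 0, where \<open>\<Phi>\<close> vanishes; the strict inequality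
  \<open>2 < k\<close> is what makes \<open>U\<close> of smaller order than the modular.\<close>

locale concave_Phi =
  fixes \<Phi> :: "real \<Rightarrow> real" and k :: real
  assumes Phi_abs: "\<Phi> \<bar>x\<bar> = \<Phi> x"
    and Phi_zero [simp]: "\<Phi> 0 = 0"
    and Phi_strict: "0 \<le> x \<Longrightarrow> x < y \<Longrightarrow> \<Phi> x < \<Phi> y"
    and Phi_cont: "continuous_on UNIV \<Phi>"
    and Phi_ray: "0 \<le> t \<Longrightarrow> t \<le> 1 \<Longrightarrow> 0 \<le> x \<Longrightarrow> t * \<Phi> x \<le> \<Phi> (t * x)"
    and k_gt_2: "2 < k"
    and Phi_k: "\<Phi> (k * x) = 2 * \<Phi> x"
begin

lemma Phi_mono: "\<bar>x\<bar> \<le> \<bar>y\<bar> \<Longrightarrow> \<Phi> x \<le> \<Phi> y"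
  using Phi_strict[of "\<bar>x\<bar>" "\<bar>y\<bar>"] Phi_abs[of x] Phi_abs[of y]
  by (cases "\<bar>x\<bar> = \<bar>y\<bar>") auto

lemma Phi_nonneg [simp]: "0 \<le> \<Phi> x"
  using Phi_mono[of 0 x] by simp

lemma Phi_pos: "x \<noteq> 0 \<Longrightarrow> 0 < \<Phi> x"
  using Phi_strict[of 0 "\<bar>x\<bar>"] Phi_abs[of x] by simp

lemma Phi_le_D: "\<Phi> x \<le> \<Phi> y \<Longrightarrow> \<bar>x\<bar> \<le> \<bar>y\<bar>"
  using Phi_strict[of "\<bar>y\<bar>" "\<bar>x\<bar>"] Phi_abs[of x] Phi_abs[of y] by force

text \<open>Up to sign, \<open>x\<close> and \<open>y\<close> are fractions of \<open>s\<close>, and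
  these fractions add up to 1; \<open>Phi_ray\<close> bounds the share of each.\<close>

lemma Phi_add: "\<Phi> (x + y) \<le> \<Phi> x + \<Phi> y"
proof -
  define s where "s = \<bar>x\<bar> + \<bar>y\<bar>"
  have "\<Phi> s \<le> \<Phi> x + \<Phi> y"
  proof (cases "s = 0")
    case False
    then have s: "0 < s" by (auto simp: s_def)
    have 1: "\<bar>x\<bar> / s * \<Phi> s \<le> \<Phi> x"
      using Phi_ray[of "\<bar>x\<bar> / s" s] s Phi_abs[of x] by (simp add: s_def)
    have 2: "\<bar>y\<bar> / s * \<Phi> s \<le> \<Phi> y"
      using Phi_ray[of "\<bar>y\<bar> / s" s] s Phi_abs[of y] by (simp add: s_def)
    have "\<Phi> s = (\<bar>x\<bar> + \<bar>y\<bar>) / s * \<Phi> s"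
      using s by (simp add: s_def)
    also have "\<dots> = \<bar>x\<bar> / s * \<Phi> s + \<bar>y\<bar> / s * \<Phi> s"
      by (simp only: add_divide_distrib distrib_right)
    finally have "\<Phi> s = \<bar>x\<bar> / s * \<Phi> s + \<bar>y\<bar> / s * \<Phi> s" .
    with 1 2 show ?thesis by linarith
  next
    case True
    then show ?thesis by simp
  qed
  moreover have "\<Phi> (x + y) \<le> \<Phi> s"
    by (rule Phi_mono) (auto simp: s_def)
  ultimately show ?thesis by linarith
qed

lemma Phi_k_power: "\<Phi> (k ^ n * x) = 2 ^ n * \<Phi> x"
  by (induction n) (auto simp: Phi_k mult.assoc)

lemma Phi_measurable [measurable]: "\<Phi> \<in> borel_measurable borel"
  using Phi_cont by (rule borel_measurable_continuous_onI)

text \<open>Every scalar lies below some power of \<open>k\<close>, which costs only a factor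
  \<open>2 ^ n\<close>; hence the Orlicz space is closed under scalar multiples.\<close>

lemma Phi_mult_le: "\<exists>n. \<forall>x. \<Phi> (c * x) \<le> 2 ^ n * \<Phi> x"
proof -
  obtain n where n: "\<bar>c\<bar> < k ^ n"
    using real_arch_pow[of k "\<bar>c\<bar>"] k_gt_2 by auto
  have "\<Phi> (c * x) \<le> 2 ^ n * \<Phi> x" for x
  proof -
    have "\<bar>c * x\<bar> \<le> \<bar>k ^ n * x\<bar>"
      using n k_gt_2 by (auto simp: abs_mult intro!: mult_right_mono)
    then show ?thesis using Phi_mono Phi_k_power by metis
  qed
  then show ?thesis by blast
qed

text \<open>\<open>\<Phi> (k ^ n) = 2 ^ n * \<Phi> 1\<close> is unbounded, so the intermediate value
  theorem gives existence; strict growth gives uniqueness, and the \<open>THE\<close> is well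
  defined.\<close>

lemma Phi_inv:
  assumes "0 \<le> y"
  shows Phi_inv_nonneg: "0 \<le> Phi_inv \<Phi> y" and Phi_Phi_inv: "\<Phi> (Phi_inv \<Phi> y) = y"
proof -
  obtain n where n: "y / \<Phi> 1 < 2 ^ n"
    using real_arch_pow[of 2 "y / \<Phi> 1"] by auto
  have "y \<le> \<Phi> (k ^ n)"
    using n Phi_pos[of 1] Phi_k_power[of n 1] by (simp add: field_simps)
  then obtain x where x: "0 \<le> x" "\<Phi> x = y"
    using IVT'[of \<Phi> 0 y "k ^ n"] assms k_gt_2 continuous_on_subset[OF Phi_cont] by auto
  have "\<exists>!x. 0 \<le> x \<and> \<Phi> x = y"
    using x by (metis Phi_le_D abs_of_nonneg order_antisym order_refl)
  from theI'[OF this] show "0 \<le> Phi_inv \<Phi> y" "\<Phi> (Phi_inv \<Phi> y) = y"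
    unfolding Phi_inv_def by auto
qed

end

section \<open>From N*-functions to the concave setting\<close>

text \<open>Squeezing the integral of the non-increasing \<open>p\<close> over \<open>{x..y}\<close>
  between \<open>p y * (y - x)\<close> and \<open>p x * (y - x)\<close> yields strict growth, the
  ray inequality and the exclusion of \<open>k = 2\<close>.\<close>

lemma Nstar_fun_concave_Phi:
  assumes "Nstar_fun \<Phi>" and k: "2 \<le> k" and dbl: "\<And>x. 0 < x \<Longrightarrow> \<Phi> (k * x) = 2 * \<Phi> x"
  shows "concave_Phi \<Phi> k"
proof -
  obtain p where pos: "\<And>t. 0 < t \<Longrightarrow> 0 < p t"
    and decr: "\<And>s t. 0 < s \<Longrightarrow> s \<le> t \<Longrightarrow> p t \<le> p s"
    and lim: "(p \<longlongrightarrow> 0) at_top"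
    and int: "\<And>x. (p has_integral \<Phi> x) {0..\<bar>x\<bar>}"
    using assms(1) unfolding Nstar_fun_def by metis
  have abs: "\<Phi> \<bar>x\<bar> = \<Phi> x" for x
    using int[of x] int[of "\<bar>x\<bar>"] by (auto intro: has_integral_unique)
  have zero: "\<Phi> 0 = 0"
    using int[of 0] by (auto intro: has_integral_unique)
  have diff: "(p has_integral (\<Phi> y - \<Phi> x)) {x..y}" if "0 \<le> x" "x \<le> y" for x y
  proof -
    have "p integrable_on {x..y}"
      using int[of y] that by (auto intro: integrable_on_subinterval has_integral_integrable)
    then obtain I where I: "(p has_integral I) {x..y}" by blast
    have "(p has_integral (\<Phi> x + I)) {0..y}"
      using has_integral_combine[OF that(1,2) _ I] int[of x] that by simp
    then have "\<Phi> y = \<Phi> x + I"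
      using int[of y] that by (auto intro: has_integral_unique)
    with I show ?thesis by simp
  qed
  have lower: "p y * (y - x) \<le> \<Phi> y - \<Phi> x" if "0 \<le> x" "x < y" for x y
  proof -
    \<comment> \<open>\<open>p\<close> is not controlled at 0, so for \<open>x = 0\<close> the
      constant is altered at this one point to stay below \<open>p\<close>.\<close>
    have c: "((\<lambda>t. if t = 0 then p 0 else p y) has_integral (p y * (y - x))) {x..y}"
    proof (rule has_integral_spike[where S = "{0}" and f = "\<lambda>_. p y"])
      show "((\<lambda>_. p y) has_integral (p y * (y - x))) {x..y}"
        using has_integral_const_real[of "p y" x y] that by (simp add: mult.commute)
    qed auto
    show ?thesis
      by (rule has_integral_le[OF c diff]) (use that decr in auto)
  qed
  have upper: "\<Phi> y - \<Phi> x \<le> p x * (y - x)" if "0 < x" "x \<le> y" for x y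
  proof -
    have c: "((\<lambda>_. p x) has_integral (p x * (y - x))) {x..y}"
      using has_integral_const_real[of "p x" x y] that by (simp add: mult.commute)
    show ?thesis
      by (rule has_integral_le[OF diff c]) (use that decr in auto)
  qed
  have strict: "\<Phi> x < \<Phi> y" if "0 \<le> x" "x < y" for x y
  proof -
    have "0 < p y * (y - x)" using pos[of y] that by simp
    with lower[OF that] show ?thesis by linarith
  qed
  have ray: "t * \<Phi> x \<le> \<Phi> (t * x)" if "0 \<le> t" "t \<le> 1" "0 \<le> x" for t x
  proof (cases "t = 0 \<or> x = 0")
    case False
    then have tx: "0 < t * x" using that by simp
    have le: "t * x \<le> x" using that by (simp add: mult_left_le_one_le)
    \<comment> \<open>\<open>p (t * x)\<close> lies between the mean slopes of \<open>\<Phi>\<close>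
      on \<open>{0..t * x}\<close> and on \<open>{t * x..x}\<close>, the first being the
      larger.\<close>
    have 1: "p (t * x) * (t * x) \<le> \<Phi> (t * x)" using lower[of 0 "t * x"] tx zero by simp
    have 2: "\<Phi> x - \<Phi> (t * x) \<le> p (t * x) * (x - t * x)" using upper[OF tx le] .
    have "t * (\<Phi> x - \<Phi> (t * x)) \<le> t * (p (t * x) * (x - t * x))"
      using 2 that by (intro mult_left_mono)
    also have "\<dots> = (1 - t) * (p (t * x) * (t * x))" by (simp add: algebra_simps)
    also have "\<dots> \<le> (1 - t) * \<Phi> (t * x)" using 1 that by (intro mult_left_mono) auto
    finally show ?thesis by (simp add: algebra_simps)
  qed (auto simp: zero)
  have "continuous_on {0..b} \<Phi>" for b
  proof (rule continuous_on_eq)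
    show "continuous_on {0..b} (\<lambda>x. integral {0..x} p)"
      by (rule indefinite_integral_continuous_1)
        (use int[of b] in \<open>cases "0 \<le> b"; auto intro: has_integral_integrable\<close>)
    show "integral {0..x} p = \<Phi> x" if "x \<in> {0..b}" for x
      using int[of x] that by (auto intro: integral_unique)
  qed
  then have "continuous_on {-b..b} (\<lambda>x. \<Phi> \<bar>x\<bar>)" for b
    by (rule continuous_on_compose2[of "{0..b}" _ _ abs]) (auto intro!: continuous_intros)
  then have cb: "continuous_on {-b..b} \<Phi>" for b
    by (simp add: abs)
  have cont: "continuous_on UNIV \<Phi>"
    unfolding continuous_on_eq_continuous_at[OF open_UNIV]
  proof safe
    fix x :: real
    have "x \<in> interior {-(\<bar>x\<bar> + 1)..\<bar>x\<bar> + 1}" by auto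
    then show "isCont \<Phi> x"
      using cb continuous_on_interior by blast
  qed
  \<comment> \<open>For \<open>k = 2\<close> the mean slope over \<open>{0..2 ^ n}\<close> would
    always be \<open>\<Phi> 1\<close>, although the slope beyond \<open>z\<close> is below
    \<open>\<Phi> 1 / 2\<close>; \<open>n\<close> is taken so large that \<open>\<Phi> z\<close>
    cannot make up the difference.\<close>
  have "2 < k"
  proof (rule ccontr)
    assume "\<not> 2 < k"
    with k dbl have d2: "\<And>x. 0 < x \<Longrightarrow> \<Phi> (2 * x) = 2 * \<Phi> x" by simp
    have pow: "\<Phi> (2 ^ n) = 2 ^ n * \<Phi> 1" for n
      by (induction n) (use d2 in auto)
    have P1: "0 < \<Phi> 1" using strict[of 0 1] zero by simp
    have "\<forall>\<^sub>F x in at_top. p x < \<Phi> 1 / 2" using order_tendstoD(2)[OF lim] half_gt_zero[OF P1] by blast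
    then obtain x0 where x0: "\<And>x. x0 \<le> x \<Longrightarrow> p x < \<Phi> 1 / 2"
      by (auto simp: eventually_at_top_linorder)
    define z where "z = max x0 1"
    have z: "0 < z" "p z < \<Phi> 1 / 2" using x0 by (auto simp: z_def)
    obtain n where n: "max z (2 * \<Phi> z / \<Phi> 1) < 2 ^ n" 
      using real_arch_pow[of 2 "max z (2 * \<Phi> z / \<Phi> 1)"] by auto
    then have n1: "z < 2 ^ n" "2 * \<Phi> z < 2 ^ n * \<Phi> 1" using P1 by (auto simp: field_simps)
    have "2 ^ n * \<Phi> 1 - \<Phi> z \<le> p z * (2 ^ n - z)"
      using upper[of z "2 ^ n"] z n1 pow by simp
    also have "\<dots> \<le> \<Phi> 1 / 2 * 2 ^ n"
      using z n1 P1 by (intro mult_mono) auto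
    finally show False using n1 by (simp add: field_simps)
  qed
  moreover have "\<Phi> (k * x) = 2 * \<Phi> x" for x
  proof (cases "x = 0")
    case False
    then have "\<Phi> (k * \<bar>x\<bar>) = 2 * \<Phi> \<bar>x\<bar>" using dbl by simp
    moreover have "k * \<bar>x\<bar> = \<bar>k * x\<bar>" using k by (simp add: abs_mult)
    ultimately show ?thesis by (simp add: abs)
  qed (simp add: zero)
  ultimately show ?thesis
    using abs zero strict cont ray by unfold_locales auto
qed

subsection \<open>Exhaustion and atoms\<close>

text \<open>Greedy choice: each new set avoids the earlier ones and has at least half the measure of
  any admissible competitor. Disjointness makes the measures summable, hence they tend to 0, and an
  admissible set that avoids all of them is null. \<open>P {}\<close> keeps the choice possible when
  nothing else is left.\<close>

lemma (in finite_measure) exhaustion: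
  assumes sets: "\<And>B. P B \<Longrightarrow> B \<in> sets M" and empty: "P {}"
  obtains B :: "nat \<Rightarrow> 'a set" where "\<And>n. P (B n)" "disjoint_family B"
    "\<And>C. P C \<Longrightarrow> C \<inter> (\<Union>n. B n) = {} \<Longrightarrow> measure M C = 0"
proof -
  have "\<exists>B. P B \<and> B \<inter> S = {} \<and> (\<forall>C. P C \<and> C \<inter> S = {} \<longrightarrow> measure M C \<le> 2 * measure M B)" for S
  proof (cases "\<forall>C. P C \<and> C \<inter> S = {} \<longrightarrow> measure M C = 0")
    case True
    with empty show ?thesis by (intro exI[of _ "{}"]) auto
  next
    case False
    define T where "T = measure M ` {C. P C \<and> C \<inter> S = {}}"
    \<comment> \<open>The supremum need not be attained, but some member exceeds its half; this is
      the origin of the factor 2.\<close>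
    have bdd: "bdd_above T"
      unfolding T_def by (rule bdd_aboveI[of _ "measure M (space M)"]) (auto intro: bounded_measure)
    obtain C0 where C0: "P C0" "C0 \<inter> S = {}" "measure M C0 \<noteq> 0"
      using False by blast
    then have "0 < measure M C0" "measure M C0 \<in> T"
      by (auto simp: T_def zero_less_measure_iff)
    then have "0 < Sup T" and ne: "T \<noteq> {}"
      using cSup_upper[OF _ bdd] by force+
    then obtain y where "y \<in> T" "Sup T / 2 < y"
      using less_cSupD[OF ne, of "Sup T / 2"] by auto
    then obtain B where B: "P B" "B \<inter> S = {}" "Sup T / 2 < measure M B"
      by (auto simp: T_def)
    have "measure M C \<le> 2 * measure M B" if "P C" "C \<inter> S = {}" for C
      using cSup_upper[OF _ bdd, of "measure M C"] B(3) that by (force simp: T_def)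
    with B show ?thesis by blast
  qed
  then obtain g where g: "\<And>S. P (g S)" "\<And>S. g S \<inter> S = {}"
    "\<And>S C. P C \<Longrightarrow> C \<inter> S = {} \<Longrightarrow> measure M C \<le> 2 * measure M (g S)"
    by metis
  \<comment> \<open>\<open>S n\<close> is the union of the sets chosen before stage
    \<open>n\<close>.\<close>
  define S where "S = rec_nat {} (\<lambda>_ S. S \<union> g S)"
  define B where "B n = g (S n)" for n
  have S_Suc: "S (Suc n) = S n \<union> B n" for n
    by (simp add: S_def B_def)
  have S_mono: "S m \<subseteq> S n" if "m \<le> n" for m n
    using that by (rule lift_Suc_mono_le[rotated]) (simp add: S_Suc)
  have S_sub: "S n \<subseteq> (\<Union>n. B n)" for n
    by (induction n) (auto simp: S_Suc, simp add: S_def)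
  have disj_lt: "B m \<inter> B n = {}" if "m < n" for m n
    using S_mono[of "Suc m" n] that g(2)[of "S n"] by (auto simp: S_Suc B_def)
  have disj: "disjoint_family B"
    unfolding disjoint_family_on_def using disj_lt by (metis Int_commute linorder_neqE_nat)
  have B_sets: "range B \<subseteq> sets M"
    using g(1) sets by (auto simp: B_def)
  have "(\<lambda>n. measure M (B n)) sums measure M (\<Union>n. B n)"
    by (rule finite_measure_UNION[OF B_sets disj])
  then have lim: "(\<lambda>n. 2 * measure M (B n)) \<longlonglongrightarrow> 0"
    using tendsto_mult_right_zero summable_LIMSEQ_zero sums_summable by blast
  have "measure M C = 0" if "P C" "C \<inter> (\<Union>n. B n) = {}" for C
  proof -
    have "measure M C \<le> 2 * measure M (B n)" for n
      unfolding B_def using that S_sub[of n] by (intro g(3)) auto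
    then have "measure M C \<le> 0"
      using LIMSEQ_le_const[OF lim] by blast
    then show ?thesis by (simp add: measure_le_0_iff)
  qed
  then show ?thesis
    using that[of B] disj g(1) by (auto simp: B_def)
qed

section \<open>Atoms of a sigma-finite measure\<close>

lemma is_atomD:
  assumes "is_atom M A"
  shows is_atom_sets: "A \<in> sets M" and is_atom_emeasure: "emeasure M A \<noteq> 0"
  using assms by (auto simp: is_atom_def)

context sigma_finite_measure
begin

text \<open>By sigma-finiteness a set of infinite measure contains one of positive finite measure,
  which an atom of infinite measure would forbid.\<close>

lemma is_atom_finite:
  assumes "is_atom M A"
  shows "emeasure M A < \<infinity>"
proof (rule ccontr)
  assume "\<not> emeasure M A < \<infinity>"
  then have inf: "emeasure M A = \<infinity>" by (simp add: less_top[symmetric])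
  obtain Z where "Z \<in> sets M" "Z \<subseteq> A" "emeasure M Z < \<infinity>" "emeasure M Z > ennreal 0"
    using approx_PInf_emeasure_with_finite[OF is_atom_sets[OF assms] inf] by blast
  with assms inf show False by (auto simp: is_atom_def)
qed

text \<open>If \<open>A - B\<close> is not null, then finiteness of the measure of \<open>A\<close>
  makes \<open>A \<inter> B\<close> strictly smaller than \<open>A\<close>, hence null.\<close>

lemma is_atom_dichotomy:
  assumes "is_atom M A" "B \<in> sets M"
  shows "emeasure M (A \<inter> B) = 0 \<or> emeasure M (A - B) = 0"
proof (rule disjCI)
  assume *: "emeasure M (A - B) \<noteq> 0"
  have A: "A \<in> sets M" using assms is_atom_sets by blast
  have "emeasure M A = emeasure M (A \<inter> B) + emeasure M (A - B)"
    using assms A by (subst plus_emeasure) (auto intro!: arg_cong[where f = "emeasure M"])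
  moreover have "emeasure M (A \<inter> B) < \<infinity>"
    using is_atom_finite[OF assms(1)] emeasure_mono[of "A \<inter> B" A M] A by (auto intro: le_less_trans)
  ultimately have "emeasure M (A \<inter> B) < emeasure M A"
    using * ennreal_add_left_cancel_less[of "emeasure M (A \<inter> B)" 0 "emeasure M (A - B)"]
    by (auto simp: zero_less_iff_neq_zero)
  with assms A show "emeasure M (A \<inter> B) = 0" by (auto simp: is_atom_def)
qed

lemma is_atomI:
  assumes A: "A \<in> sets M" "emeasure M A \<noteq> 0"
    and "\<And>B. B \<in> sets M \<Longrightarrow> B \<subseteq> A \<Longrightarrow> emeasure M B = 0 \<or> emeasure M (A - B) = 0"
  shows "is_atom M A"
  unfolding is_atom_def
proof safe
  fix B assume B: "B \<in> sets M" "B \<subseteq> A" "emeasure M B < emeasure M A"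
  have "emeasure M A = emeasure M B + emeasure M (A - B)"
    using A B by (subst plus_emeasure) (auto intro!: arg_cong[where f = "emeasure M"])
  with assms(3)[OF B(1,2)] B(3) show "emeasure M B = 0" by auto
qed (use A in \<open>auto simp: zero_less_iff_neq_zero\<close>)

lemma is_atom_not_AE_False:
  assumes "is_atom M A" "AE x in M. x \<notin> A"
  shows False
  using assms is_atomD[OF assms(1)] AE_iff_measurable[of A M "\<lambda>x. x \<notin> A"] sets.sets_into_space[of A M]
  by (auto simp: subset_eq)

lemma is_atom_AE_dichotomy:
  assumes "is_atom M A" "{x \<in> space M. P x} \<in> sets M"
  shows "(AE x in M. x \<in> A \<longrightarrow> P x) \<or> (AE x in M. x \<in> A \<longrightarrow> \<not> P x)"
proof -
  let ?B = "{x \<in> space M. P x}"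
  have A: "A \<in> sets M" using assms is_atom_sets by blast
  consider "A \<inter> ?B \<in> null_sets M" | "A - ?B \<in> null_sets M"
    using is_atom_dichotomy[OF assms] A assms(2) by (auto simp: null_sets_def)
  then show ?thesis
  proof cases
    case 1
    from AE_not_in[OF 1] have "AE x in M. x \<in> A \<longrightarrow> \<not> P x"
      by (rule AE_mp) (auto intro!: AE_I2)
    then show ?thesis by blast
  next
    case 2
    from AE_not_in[OF 2] have "AE x in M. x \<in> A \<longrightarrow> P x"
      by (rule AE_mp) (auto intro!: AE_I2)
    then show ?thesis by blast
  qed
qed

text \<open>By the dichotomy each level \<open>t\<close> satisfies \<open>f x \<le> t\<close> a.e.
  on \<open>A\<close> or \<open>t < f x\<close> a.e. on \<open>A\<close>. The constant is the
  infimum of the levels of the first kind; it is finite since \<open>A\<close> is not null, and the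
  countably many levels at distance \<open>1 / Suc n\<close> around it pin \<open>f\<close>
  down.\<close>

lemma is_atom_AE_const:
  fixes f :: "'a \<Rightarrow> real"
  assumes A: "is_atom M A" and f [measurable]: "f \<in> borel_measurable M"
  shows "\<exists>c. AE x in M. x \<in> A \<longrightarrow> f x = c"
proof -
  define G where "G = {t. AE x in M. x \<in> A \<longrightarrow> f x \<le> t}"
  have G: "AE x in M. x \<in> A \<longrightarrow> t < f x" if "t \<notin> G" for t
    using is_atom_AE_dichotomy[OF A, of "\<lambda>x. f x \<le> t"] that by (auto simp: G_def not_le)
  have up: "s \<in> G" if "t \<in> G" "t \<le> s" for s t
  proof -
    from that(1) have "AE x in M. x \<in> A \<longrightarrow> f x \<le> t" by (simp add: G_def)
    then have "AE x in M. x \<in> A \<longrightarrow> f x \<le> s"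
      by eventually_elim (use that(2) in auto)
    then show ?thesis by (simp add: G_def)
  qed
  have ne: "G \<noteq> {}"
  proof
    assume "G = {}"
    then have "AE x in M. \<forall>n. x \<in> A \<longrightarrow> real n < f x"
      unfolding AE_all_countable using G by blast
    then have "AE x in M. x \<notin> A"
      by eventually_elim (meson reals_Archimedean2 less_asym)
    then show False using is_atom_not_AE_False A by blast
  qed
  have bdd: "bdd_below G"
  proof (rule ccontr)
    assume "\<not> bdd_below G"
    then have "- real n \<in> G" for n
      using up by (meson bdd_belowI linear)
    then have "AE x in M. \<forall>n. x \<in> A \<longrightarrow> f x \<le> - real n"
      unfolding AE_all_countable by (auto simp: G_def)
    then have "AE x in M. x \<notin> A"
    proof (rule AE_mp, intro AE_I2 impI notI)
      fix x assume *: "\<forall>n. x \<in> A \<longrightarrow> f x \<le> - real n" "x \<in> A"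
      obtain n where "- f x < real n" using reals_Archimedean2 by blast
      moreover have "f x \<le> - real n" using * by blast
      ultimately show False by linarith
    qed
    then show False using is_atom_not_AE_False A by blast
  qed
  define c where "c = Inf G"
  have 1: "AE x in M. \<forall>n. x \<in> A \<longrightarrow> c - inverse (real (Suc n)) < f x"
    unfolding AE_all_countable
  proof
    fix n
    have "c - inverse (real (Suc n)) \<notin> G"
      using cInf_lower[OF _ bdd, of "c - inverse (real (Suc n))"] by (auto simp: c_def)
    from G[OF this] show "AE x in M. x \<in> A \<longrightarrow> c - inverse (real (Suc n)) < f x" .
  qed
  have 2: "AE x in M. \<forall>n. x \<in> A \<longrightarrow> f x \<le> c + inverse (real (Suc n))"
    unfolding AE_all_countable
  proof
    fix n
    have "Inf G < c + inverse (real (Suc n))" by (simp add: c_def)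
    then obtain t where "t \<in> G" "t < c + inverse (real (Suc n))"
      using cInf_lessD[OF ne] by blast
    then show "AE x in M. x \<in> A \<longrightarrow> f x \<le> c + inverse (real (Suc n))"
      using up[of t "c + inverse (real (Suc n))"] by (simp add: G_def)
  qed
  have "AE x in M. x \<in> A \<longrightarrow> f x = c"
    using 1 2
  proof eventually_elim
    case (elim x)
    show ?case
    proof (rule impI, rule ccontr)
      assume "x \<in> A" "f x \<noteq> c"
      then obtain n where "inverse (real (Suc n)) < \<bar>f x - c\<bar>"
        using reals_Archimedean[of "\<bar>f x - c\<bar>"] by auto
      with elim \<open>x \<in> A\<close> show False by (smt (verit))
    qed
  qed
  then show ?thesis by blast
qed

lemma atom_value_eqI:
  assumes A: "is_atom M A" and c: "AE x in M. x \<in> A \<longrightarrow> f x = c"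
  shows "atom_value M f A = c"
  unfolding atom_value_def
proof (rule the_equality)
  show "AE x in M. x \<in> A \<longrightarrow> f x = c" by (rule c)
  fix d assume d: "AE x in M. x \<in> A \<longrightarrow> f x = d"
  show "d = c"
  proof (rule ccontr)
    assume "d \<noteq> c"
    from c d have "AE x in M. x \<notin> A"
      by eventually_elim (use \<open>d \<noteq> c\<close> in auto)
    then show False using is_atom_not_AE_False A by blast
  qed
qed

lemma AE_atom_value:
  assumes "is_atom M A" "f \<in> borel_measurable M"
  shows "AE x in M. x \<in> A \<longrightarrow> f x = atom_value M f A"
  using is_atom_AE_const[OF assms] atom_value_eqI[OF assms(1)] by metis

text \<open>Exhaustion by atoms, with empty sets as padding; the index set drops the padding. The
  last conclusion says that the complement of the listed atoms is atom-free.\<close>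

lemma atom_enumeration_exists:
  obtains A :: "nat \<Rightarrow> 'a set" where "atom_enumeration M {n. A n \<noteq> {}} A"
    "range A \<subseteq> sets M" "disjoint_family A" "\<And>B. is_atom M B \<Longrightarrow> \<not> B \<subseteq> - (\<Union>n. A n)"
proof -
  obtain h where h [measurable]: "h \<in> borel_measurable M" and h_fin: "integral\<^sup>N M h \<noteq> \<infinity>"
    and h_pos: "\<And>x. x \<in> space M \<Longrightarrow> 0 < h x"
    using Ex_finite_integrable_function by blast
  \<comment> \<open>Exhaustion needs a finite measure: a strictly positive integrable density
    supplies one whose null sets are null for \<open>M\<close>.\<close>
  define N where "N = density M h"
  have sets_N [simp]: "sets N = sets M" by (simp add: N_def)
  interpret N: finite_measure N
  proof
    have "emeasure N (space N) = integral\<^sup>N M h"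
      by (auto simp: N_def emeasure_density intro!: nn_integral_cong)
    then show "emeasure N (space N) \<noteq> \<infinity>" using h_fin by simp
  qed
  have null: "emeasure M B = 0" if "B \<in> sets M" "measure N B = 0" for B
  proof -
    have "B \<in> null_sets (density M h)"
      using that N.emeasure_eq_measure[of B] by (auto simp: N_def null_sets_def)
    then have "AE x in M. x \<in> B \<longrightarrow> h x = 0"
      by (simp add: null_sets_density_iff)
    then have "AE x in M. x \<notin> B"
      by (rule AE_mp) (use h_pos in \<open>force intro!: AE_I2\<close>)
    then show ?thesis
      using that AE_iff_null_sets[of B M] by (simp add: null_sets_def)
  qed
  have P_sets: "B \<in> sets N" if "is_atom M B \<or> B = {}" for B
    using that by (auto dest: is_atom_sets)
  obtain A :: "nat \<Rightarrow> 'a set" where A: "\<And>n. is_atom M (A n) \<or> A n = {}" and disj: "disjoint_family A"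
    and max: "\<And>C. is_atom M C \<or> C = {} \<Longrightarrow> C \<inter> (\<Union>n. A n) = {} \<Longrightarrow> measure N C = 0"
    by (rule N.exhaustion[of "\<lambda>B. is_atom M B \<or> B = {}", OF P_sets]) blast+
  have A_sets [measurable]: "A n \<in> sets M" for n
    using A[of n] by (auto dest: is_atom_sets)
  have no_atom: "\<not> B \<subseteq> - (\<Union>n. A n)" if "is_atom M B" for B
    using max[of B] null[of B] that is_atomD[OF that] by auto
  have "\<exists>!i. i \<in> {n. A n \<noteq> {}} \<and> emeasure M ((B - A i) \<union> (A i - B)) = 0" if B: "is_atom M B" for B
  proof -
    have B_sets [measurable]: "B \<in> sets M" using B by (rule is_atom_sets)
    \<comment> \<open>If \<open>B\<close> met every \<open>A n\<close> in a null set, then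
      \<open>B\<close> without the union would still be an atom, against maximality.\<close>
    have "\<exists>n. emeasure M (B \<inter> A n) \<noteq> 0"
    proof (rule ccontr)
      assume "\<not> ?thesis"
      then have "(\<Union>n. B \<inter> A n) \<in> null_sets M"
        by (intro null_sets_UN) (auto simp: null_sets_def)
      then have N0: "B \<inter> (\<Union>n. A n) \<in> null_sets M" by simp
      have eq: "emeasure M (B \<inter> C - (\<Union>n. A n)) = emeasure M (B \<inter> C)" if "C \<in> sets M" for C
      proof -
        have "B \<inter> C - (\<Union>n. A n) = B \<inter> C - B \<inter> (\<Union>n. A n)" by auto
        then show ?thesis using emeasure_Diff_null_set[OF N0, of "B \<inter> C"] that by simp
      qed
      have "is_atom M (B - (\<Union>n. A n))"
      proof (rule is_atomI)
        show "emeasure M (B - (\<Union>n. A n)) \<noteq> 0"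
          using eq[of B] is_atom_emeasure[OF B] by simp
        fix C assume C: "C \<in> sets M" "C \<subseteq> B - (\<Union>n. A n)"
        then have "B \<inter> C = C" by auto
        moreover have "emeasure M (B - (\<Union>n. A n) - C) \<le> emeasure M (B - C)"
          using C by (intro emeasure_mono) auto
        ultimately show "emeasure M C = 0 \<or> emeasure M (B - (\<Union>n. A n) - C) = 0"
          using is_atom_dichotomy[OF B C(1)] by (auto simp: le_zero_eq)
      qed simp
      then show False using no_atom by blast
    qed
    then obtain i where i: "emeasure M (B \<inter> A i) \<noteq> 0" by blast
    then have Ai: "is_atom M (A i)" using A[of i] by auto
    \<comment> \<open>The dichotomy is used twice, for the atom \<open>B\<close> cut by
      \<open>A i\<close> and for the atom \<open>A i\<close> cut by \<open>B\<close>.\<close>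
    have "emeasure M (B - A i) = 0" "emeasure M (A i - B) = 0"
      using i is_atom_dichotomy[OF B A_sets[of i]] is_atom_dichotomy[OF Ai B_sets]
      by (auto simp: Int_commute)
    then have "(B - A i) \<union> (A i - B) \<in> null_sets M"
      by (intro null_sets.Un) (auto simp: null_sets_def)
    then have e: "emeasure M ((B - A i) \<union> (A i - B)) = 0" by (auto simp: null_sets_def)
    show ?thesis
    proof (rule ex1I[of _ i])
      show "i \<in> {n. A n \<noteq> {}} \<and> emeasure M ((B - A i) \<union> (A i - B)) = 0"
        using e i by auto
      fix j assume j: "j \<in> {n. A n \<noteq> {}} \<and> emeasure M ((B - A j) \<union> (A j - B)) = 0"
      show "j = i"
      proof (rule ccontr)
        assume "j \<noteq> i"
        then have "A i \<inter> A j = {}" using disj by (auto simp: disjoint_family_on_def)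
        then have "B \<inter> A i \<subseteq> (B - A j) \<union> (A j - B)" by auto
        then have "emeasure M (B \<inter> A i) \<le> emeasure M ((B - A j) \<union> (A j - B))"
          by (intro emeasure_mono) auto
        with i j show False by simp
      qed
    qed
  qed
  moreover have "is_atom M (A n)" if "A n \<noteq> {}" for n
    using A[of n] that by blast
  ultimately have "atom_enumeration M {n. A n \<noteq> {}} A"
    unfolding atom_enumeration_def using disj by (auto simp: disjoint_family_on_def)
  then show ?thesis
    using that[of A] disj no_atom A_sets by blast
qed

end

subsection \<open>The modular and the quasi-norm\<close>

locale Orlicz = sigma_finite_measure M + concave_Phi \<Phi> k
  for M :: "'a measure" and \<Phi> :: "real \<Rightarrow> real" and k :: real
begin

abbreviation "L \<equiv> Orlicz_space M \<Phi>"

text \<open>Unlike the quasi-norm, this is additive over disjoint supports; the estimates are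
  therefore made with it.\<close>

definition modular :: "('a \<Rightarrow> real) \<Rightarrow> ennreal" where
  "modular f = (\<integral>\<^sup>+ x. ennreal (\<Phi> (f x)) \<partial>M)"

lemma L_iff: "f \<in> L \<longleftrightarrow> f \<in> borel_measurable M \<and> modular f < \<infinity>"
  by (simp add: Orlicz_space_def modular_def)

lemma L_measurable: "f \<in> L \<Longrightarrow> f \<in> borel_measurable M"
  by (simp add: L_iff)

lemma modular_mono: "(\<And>x. \<bar>f x\<bar> \<le> \<bar>g x\<bar>) \<Longrightarrow> modular f \<le> modular g"
  unfolding modular_def by (intro nn_integral_mono ennreal_leI Phi_mono)

lemma modular_add:
  assumes "f \<in> borel_measurable M" "g \<in> borel_measurable M"
  shows "modular (\<lambda>x. f x + g x) \<le> modular f + modular g"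
proof -
  have "modular (\<lambda>x. f x + g x) \<le> (\<integral>\<^sup>+ x. ennreal (\<Phi> (f x)) + ennreal (\<Phi> (g x)) \<partial>M)"
    unfolding modular_def
    by (intro nn_integral_mono) (simp add: Phi_add ennreal_leI flip: ennreal_plus)
  also have "\<dots> = modular f + modular g"
    unfolding modular_def using assms by (intro nn_integral_add) auto
  finally show ?thesis .
qed

lemma modular_cong_AE: "AE x in M. f x = g x \<Longrightarrow> modular f = modular g"
  unfolding modular_def by (rule nn_integral_cong_AE) auto

lemma modular_k_power:
  assumes "f \<in> borel_measurable M"
  shows "modular (\<lambda>x. k ^ n * f x) = 2 ^ n * modular f"
  unfolding modular_def using assms
  by (subst nn_integral_cmult[symmetric]) (auto simp: Phi_k_power ennreal_mult ennreal_power[symmetric])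

lemma L_cmult:
  assumes f: "f \<in> L"
  shows "(\<lambda>x. c * f x) \<in> L"
proof -
  note [measurable] = L_measurable[OF f]
  obtain n where n: "\<And>x. \<Phi> (c * x) \<le> 2 ^ n * \<Phi> x"
    using Phi_mult_le[of c] by blast
  have "modular (\<lambda>x. c * f x) \<le> (\<integral>\<^sup>+ x. ennreal (2 ^ n * \<Phi> (f x)) \<partial>M)"
    unfolding modular_def by (intro nn_integral_mono ennreal_leI n)
  also have "\<dots> = 2 ^ n * modular f"
    unfolding modular_def
    by (subst nn_integral_cmult[symmetric]) (auto simp: ennreal_mult ennreal_power[symmetric])
  also have "\<dots> < \<infinity>"
    using f by (auto simp: L_iff ennreal_mult_less_top power_less_top_ennreal)
  finally show ?thesis by (simp add: L_iff)
qed

lemma L_add: "f \<in> L \<Longrightarrow> g \<in> L \<Longrightarrow> (\<lambda>x. f x + g x) \<in> L"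
  using modular_add[of f g] by (auto simp: L_iff intro: le_less_trans)

lemma L_lincomb: "f \<in> L \<Longrightarrow> g \<in> L \<Longrightarrow> (\<lambda>x. a * f x + b * g x) \<in> L"
  by (intro L_add L_cmult)

lemma L_zero: "(\<lambda>_. 0) \<in> L"
  by (simp add: L_iff modular_def)

lemma L_diff: "f \<in> L \<Longrightarrow> g \<in> L \<Longrightarrow> (\<lambda>x. f x - g x) \<in> L"
  using L_lincomb[of f g 1 "-1"] by simp

lemma L_restrict: "f \<in> L \<Longrightarrow> B \<in> sets M \<Longrightarrow> (\<lambda>x. indicator B x * f x) \<in> L"
  using modular_mono[of "\<lambda>x. indicator B x * f x" f]
  by (auto simp: L_iff abs_mult mult_left_le_one_le intro: le_less_trans)

lemma modular_const_indicator:
  "B \<in> sets M \<Longrightarrow> modular (\<lambda>x. c * indicator B x) = ennreal (\<Phi> c) * emeasure M B"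
  unfolding modular_def
  by (subst nn_integral_cmult_indicator[symmetric]) (auto simp: indicator_def intro!: nn_integral_cong)

lemma qnorm_le:
  assumes "0 < r" "modular (\<lambda>x. f x / r) \<le> 1"
  shows "Orlicz_qnorm M \<Phi> f \<le> r"
  unfolding Orlicz_qnorm_def
proof (rule cInf_lower)
  have "\<Phi> (\<bar>f x\<bar> / r) = \<Phi> (f x / r)" for x
    using assms Phi_abs[of "f x / r"] by simp
  then show "r \<in> {r. 0 < r \<and> (\<integral>\<^sup>+ x. ennreal (\<Phi> (\<bar>f x\<bar> / r)) \<partial>M) \<le> 1}"
    using assms by (simp add: modular_def)
qed (auto intro!: bdd_belowI[of _ 0])

text \<open>The infimum is over a nonempty set, because dividing \<open>f\<close> by
  \<open>k ^ n\<close> divides the modular by \<open>2 ^ n\<close>. Any \<open>r\<close> above the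
  infimum exceeds an admissible \<open>s\<close>, and a larger divisor only lowers the
  modular.\<close>

lemma modular_le_1_if_qnorm_less:
  assumes f: "f \<in> L" and r: "Orlicz_qnorm M \<Phi> f < r"
  shows "0 < r" "modular (\<lambda>x. f x / r) \<le> 1"
proof -
  let ?S = "{r. 0 < r \<and> (\<integral>\<^sup>+ x. ennreal (\<Phi> (\<bar>f x\<bar> / r)) \<partial>M) \<le> 1}"
  have abs: "\<Phi> (\<bar>f x\<bar> / s) = \<Phi> (f x / s)" if "0 < s" for s x
    using that Phi_abs[of "f x / s"] by simp
  obtain m where m: "modular f = ennreal m" "0 \<le> m"
    using f by (cases "modular f") (auto simp: L_iff)
  obtain n where n: "m < 2 ^ n" using real_arch_pow[of 2 m] by auto
  have kn: "0 < k ^ n" using k_gt_2 by simp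
  note [measurable] = L_measurable[OF f]
  have "(\<lambda>x. k ^ n * (f x / k ^ n)) = f"
    using k_gt_2 by (auto simp: fun_eq_iff)
  then have "2 ^ n * modular (\<lambda>x. f x / k ^ n) = modular f"
    using modular_k_power[of "\<lambda>x. f x / k ^ n" n] by simp
  also have "\<dots> \<le> 2 ^ n * 1"
    using n ennreal_leI[of m "2 ^ n"] by (simp add: m ennreal_power[symmetric])
  finally have "modular (\<lambda>x. f x / k ^ n) \<le> 1"
    using ennreal_mult_le_mult_iff[of "2 ^ n" _ 1] by (auto simp: power_eq_top_ennreal)
  then have "k ^ n \<in> ?S" using kn abs by (simp add: modular_def)
  then have "?S \<noteq> {}" by blast
  from cInf_lessD[OF this r[unfolded Orlicz_qnorm_def]]
  obtain s where s: "s \<in> ?S" "s < r" by blast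
  then have s0: "0 < s" by simp
  with s(2) show "0 < r" by linarith
  have "\<bar>f x\<bar> / r \<le> \<bar>f x\<bar> / s" for x
    using s0 s(2) by (simp add: divide_left_mono)
  then have "modular (\<lambda>x. f x / r) \<le> modular (\<lambda>x. f x / s)"
    using s0 s(2) by (intro modular_mono) (simp add: abs_divide)
  also have "\<dots> \<le> 1" using s(1) abs[OF s0] by (simp add: modular_def)
  finally show "modular (\<lambda>x. f x / r) \<le> 1" .
qed

text \<open>Continuity at 0 with tolerance 1 gives \<open>\<delta>\<close>; scaling by
  \<open>\<delta> / 2\<close> moves the modular unit ball inside the quasi-norm ball of radius
  \<open>\<delta>\<close>.\<close>

lemma continuous_bounded:
  assumes lin: "linear_functional M \<Phi> U" and cont: "continuous_functional M \<Phi> U"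
  shows "\<exists>K. \<forall>g\<in>L. modular g \<le> 1 \<longrightarrow> \<bar>U g\<bar> \<le> K"
proof -
  have scale: "U (\<lambda>x. c * f x) = c * U f" if "f \<in> L" for c f
    using lin[unfolded linear_functional_def, rule_format, OF that that, of c 0] by simp
  have U0: "U (\<lambda>_. 0) = 0" using scale[OF L_zero, of 0] by simp
  obtain \<delta> where \<delta>: "0 < \<delta>"
    and small: "\<And>g. g \<in> L \<Longrightarrow> Orlicz_qnorm M \<Phi> g < \<delta> \<Longrightarrow> \<bar>U g\<bar> < 1"
    using cont[unfolded continuous_functional_def, rule_format, OF L_zero, of 1] by (auto simp: U0)
  have "\<bar>U g\<bar> \<le> 2 / \<delta>" if g: "g \<in> L" "modular g \<le> 1" for g
  proof -
    have "Orlicz_qnorm M \<Phi> (\<lambda>x. \<delta> / 2 * g x) \<le> \<delta> / 2"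
      using g \<delta> by (intro qnorm_le) auto
    then have "\<bar>U (\<lambda>x. \<delta> / 2 * g x)\<bar> < 1"
      using \<delta> g by (intro small L_cmult) auto
    then have "\<delta> / 2 * \<bar>U g\<bar> < 1"
      using \<delta> by (simp add: scale[OF g(1), of "\<delta> / 2"] abs_mult del: times_divide_eq_left)
    then show ?thesis using \<delta> by (simp add: field_simps)
  qed
  then show ?thesis by blast
qed

end

section \<open>Functionals bounded on the modular unit ball\<close>

locale bounded_functional = Orlicz +
  fixes U :: "('a \<Rightarrow> real) \<Rightarrow> real" and K :: real
  assumes respects: "respects_ae M \<Phi> U"
    and linear: "linear_functional M \<Phi> U"
    and bound: "g \<in> L \<Longrightarrow> modular g \<le> 1 \<Longrightarrow> \<bar>U g\<bar> \<le> K"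
begin

lemma U_cmult: "f \<in> L \<Longrightarrow> U (\<lambda>x. c * f x) = c * U f"
  using linear[unfolded linear_functional_def, rule_format, of f f c 0] by simp

lemma U_add: "f \<in> L \<Longrightarrow> g \<in> L \<Longrightarrow> U (\<lambda>x. f x + g x) = U f + U g"
  using linear[unfolded linear_functional_def, rule_format, of f g 1 1] by simp

lemma U_cong_AE: "f \<in> L \<Longrightarrow> g \<in> L \<Longrightarrow> AE x in M. f x = g x \<Longrightarrow> U f = U g"
  using respects unfolding respects_ae_def by blast

lemma U_zero: "U (\<lambda>_. 0) = 0"
  using U_cmult[OF L_zero, of 0] by simp

lemma K_nonneg: "0 \<le> K"
  using bound[OF L_zero] by (simp add: U_zero modular_def)

text \<open>Multiplying \<open>g\<close> by \<open>k ^ n\<close> raises the modular by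
  \<open>2 ^ n\<close> only, so the product is still in the modular unit ball.\<close>

lemma U_le_k_power:
  assumes g: "g \<in> L" and m: "modular g \<le> ennreal (1 / 2 ^ n)"
  shows "\<bar>U g\<bar> \<le> K / k ^ n"
proof -
  have "modular (\<lambda>x. k ^ n * g x) = ennreal (2 ^ n) * modular g"
    using L_measurable[OF g] by (simp add: modular_k_power flip: ennreal_power)
  also have "\<dots> \<le> ennreal (2 ^ n) * ennreal (1 / 2 ^ n)" by (intro mult_left_mono m) auto
  also have "\<dots> = 1" by (subst ennreal_mult[symmetric]) auto
  finally have "\<bar>U (\<lambda>x. k ^ n * g x)\<bar> \<le> K" using g by (intro bound L_cmult)
  then have "k ^ n * \<bar>U g\<bar> \<le> K" using k_gt_2 by (simp add: U_cmult[OF g] abs_mult)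
  then show ?thesis using k_gt_2 by (simp add: field_simps)
qed

text \<open>If \<open>I(g)\<close> is about \<open>2\<^sup>-\<^sup>n\<close>, then \<open>|U g| \<le> K k\<^sup>-\<^sup>n\<close>, and \<open>(2/k)\<^sup>n\<close> tends to 0 because \<open>k > 2\<close>.\<close>

lemma U_little_o:
  assumes "0 < c"
  obtains e where "0 < e"
    "\<And>g. g \<in> L \<Longrightarrow> modular g \<le> ennreal e \<Longrightarrow> \<bar>U g\<bar> \<le> c * enn2real (modular g)"
proof -
  have pow0: "(\<lambda>n. C * q ^ n) \<longlonglongrightarrow> 0" if "0 \<le> q" "q < 1" for C q :: real
    using tendsto_mult_right_zero[OF LIMSEQ_realpow_zero[OF that]] .
  \<comment> \<open>The factor 2 pays for rounding the modular \<open>m\<close> to a power of 2,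
    where \<open>1 / 2 ^ n < 2 * m\<close>.\<close>
  have "\<forall>\<^sub>F n in sequentially. (2 * K) * (2 / k) ^ n < c"
    using k_gt_2 assms by (intro order_tendstoD(2)[OF pow0]) auto
  then obtain j where j: "\<And>n. j \<le> n \<Longrightarrow> (2 * K) * (2 / k) ^ n < c"
    by (auto simp: eventually_sequentially)
  have "\<bar>U g\<bar> \<le> c * enn2real (modular g)"
    if g: "g \<in> L" and m: "modular g \<le> ennreal (1 / 2 ^ j)" for g
  proof -
    define m where "m = enn2real (modular g)"
    have mod: "modular g = ennreal m"
      using g by (simp add: m_def L_iff)
    have m0: "0 \<le> m" by (simp add: m_def)
    have mj: "m \<le> 1 / 2 ^ j" using m by (simp add: mod)
    show ?thesis
    proof (cases "m = 0")
      case True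
      have "\<bar>U g\<bar> \<le> K * (1 / k) ^ n" for n
        using U_le_k_power[OF g, of n] True by (simp add: mod power_divide)
      moreover have "(\<lambda>n. K * (1 / k) ^ n) \<longlonglongrightarrow> 0"
        using k_gt_2 by (intro pow0) auto
      ultimately have "\<bar>U g\<bar> \<le> 0"
        using LIMSEQ_le_const by blast
      then show ?thesis using True by (simp add: m_def)
    next
      case False
      with m0 have mpos: "0 < m" by simp
      have "\<exists>n. 1 / 2 ^ n < m"
        using real_arch_pow_inv[OF mpos, of "1 / 2"] by (simp add: power_divide)
      then have ex: "1 / 2 ^ (LEAST n. 1 / 2 ^ n < m) < m" by (rule LeastI_ex)
      \<comment> \<open>\<open>N\<close> is the first exponent with \<open>1 / 2 ^ N < m\<close>;
        its predecessor \<open>n\<close> satisfies \<open>m \<le> 1 / 2 ^ n\<close>, and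
        \<open>m \<le> 1 / 2 ^ j\<close> ensures \<open>j \<le> n\<close>.\<close>
      define N where "N = (LEAST n. 1 / 2 ^ n < m)"
      have N: "1 / 2 ^ N < m" using ex by (simp add: N_def)
      have "j < N"
      proof (rule ccontr)
        assume "\<not> j < N"
        then have "(1::real) / 2 ^ j \<le> 1 / 2 ^ N" by (intro divide_left_mono power_increasing) auto
        with N mj show False by linarith
      qed
      then obtain n where n: "N = Suc n" "j \<le> n" by (cases N) auto
      have "\<not> 1 / 2 ^ n < m" using not_less_Least[of n "\<lambda>n. 1 / 2 ^ n < m"] n by (simp add: N_def)
      then have "\<bar>U g\<bar> \<le> K / k ^ n"
        by (intro U_le_k_power[OF g]) (simp add: mod)
      also have "\<dots> = K * (2 / k) ^ n * (1 / 2 ^ n)"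
        by (simp add: power_divide)
      also have "\<dots> \<le> K * (2 / k) ^ n * (2 * m)"
        using N n K_nonneg k_gt_2 by (intro mult_left_mono) (auto simp: field_simps)
      also have "\<dots> = (2 * K) * (2 / k) ^ n * m" by simp
      also have "\<dots> \<le> c * m"
        using j[OF n(2)] m0 by (intro mult_right_mono) auto
      finally show ?thesis by (simp add: m_def)
    qed
  qed
  then show ?thesis using that[of "1 / 2 ^ j"] by simp
qed

end

subsection \<open>Countable additivity and atom-free sets\<close>

context Orlicz
begin

definition restr :: "('a \<Rightarrow> real) \<Rightarrow> 'a set \<Rightarrow> 'a \<Rightarrow> real" where
  "restr f B = (\<lambda>x. indicator B x * f x)"

text \<open>A finite measure for \<open>f\<close> in \<open>L\<close>, with value
  \<open>modular (restr f B)\<close> at \<open>B\<close>: it turns modular bounds on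
  \<open>U (restr f B)\<close> into bounds by a measure.\<close>

definition nu :: "('a \<Rightarrow> real) \<Rightarrow> 'a measure" where
  "nu f = density M (\<lambda>x. ennreal (\<Phi> (f x)))"

lemma restr_in_L: "f \<in> L \<Longrightarrow> B \<in> sets M \<Longrightarrow> restr f B \<in> L"
  unfolding restr_def by (rule L_restrict)

lemma sets_nu [simp, measurable_cong]: "sets (nu f) = sets M"
  by (simp add: nu_def)

lemma emeasure_nu:
  assumes "f \<in> L" "B \<in> sets M"
  shows "emeasure (nu f) B = modular (restr f B)"
  unfolding nu_def modular_def restr_def using assms L_measurable[of f]
  by (subst emeasure_density) (auto simp: indicator_def intro!: nn_integral_cong)

lemma finite_measure_nu:
  assumes "f \<in> L"
  shows "finite_measure (nu f)"
proof
  show "emeasure (nu f) (space (nu f)) \<noteq> \<infinity>"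
    using emeasure_nu[OF assms sets.top] restr_in_L[OF assms sets.top] sets_eq_imp_space_eq[OF sets_nu]
    by (auto simp: L_iff)
qed

lemma modular_restr:
  assumes "f \<in> L" "B \<in> sets M"
  shows "modular (restr f B) = ennreal (measure (nu f) B)"
  using emeasure_nu[OF assms] finite_measure.emeasure_eq_measure[OF finite_measure_nu[OF assms(1)], of B]
  by simp

lemma null_sets_nu_iff:
  assumes "f \<in> L" "B \<in> sets M"
  shows "measure (nu f) B = 0 \<longleftrightarrow> (AE x in M. x \<in> B \<longrightarrow> f x = 0)"
proof -
  have "measure (nu f) B = 0 \<longleftrightarrow> B \<in> null_sets (nu f)"
    using assms finite_measure.emeasure_eq_measure[OF finite_measure_nu[OF assms(1)], of B]
    by (auto simp: null_sets_def)
  also have "\<dots> \<longleftrightarrow> (AE x in M. x \<in> B \<longrightarrow> \<Phi> (f x) = 0)"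
    using assms L_measurable[of f] by (auto simp: nu_def null_sets_density_iff ennreal_eq_0_iff antisym)
  also have "\<dots> \<longleftrightarrow> (AE x in M. x \<in> B \<longrightarrow> f x = 0)"
    using Phi_pos by (intro AE_cong) (metis Phi_zero less_irrefl)
  finally show ?thesis .
qed

text \<open>On an atom-free set the finite measure \<open>\<Phi>(f) \<mu>\<close> takes arbitrarily small positive values:
  split repeatedly and keep the smaller half.\<close>

lemma small_subset_of_atomfree:
  assumes f: "f \<in> L" and R: "R \<in> sets M" and atomfree: "\<And>B. is_atom M B \<Longrightarrow> \<not> B \<subseteq> R"
    and pos: "measure (nu f) R \<noteq> 0" and "0 < e"
  shows "\<exists>C\<in>sets M. C \<subseteq> R \<and> 0 < measure (nu f) C \<and> measure (nu f) C \<le> e"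
proof -
  note [measurable] = L_measurable[OF f] R
  interpret nu: finite_measure "nu f" using f by (rule finite_measure_nu)
  have split: "\<exists>B\<in>sets M. B \<subseteq> C \<and> 0 < measure (nu f) B \<and> measure (nu f) B \<le> measure (nu f) C / 2"
    if C [measurable]: "C \<in> sets M" and CR: "C \<subseteq> R" and Cpos: "0 < measure (nu f) C" for C
  proof -
    \<comment> \<open>\<open>D\<close> carries all the \<open>nu f\<close>-measure of
      \<open>C\<close>, and subsets of \<open>D\<close> that are null for \<open>nu f\<close> are
      null for \<open>M\<close>.\<close>
    define D where "D = {x \<in> space M. x \<in> C \<and> f x \<noteq> 0}"
    have D [measurable]: "D \<in> sets M" unfolding D_def by measurable
    have DC: "D \<subseteq> C" by (auto simp: D_def)
    have null: "B \<in> null_sets M" if "B \<in> sets M" "B \<subseteq> D" "measure (nu f) B = 0" for B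
    proof -
      have "AE x in M. x \<in> B \<longrightarrow> f x = 0" using null_sets_nu_iff[OF f that(1)] that(3) by blast
      then have "AE x in M. x \<notin> B"
        by eventually_elim (use that(2) in \<open>auto simp: D_def\<close>)
      then show ?thesis using that(1) by (simp add: AE_iff_null_sets)
    qed
    have "measure (nu f) (C - D) = 0"
      using null_sets_nu_iff[OF f, of "C - D"] by (auto simp: D_def intro!: AE_I2)
    then have CD: "measure (nu f) D = measure (nu f) C"
      using nu.finite_measure_Diff[of C D] DC by simp
    have "emeasure M D \<noteq> 0"
    proof
      assume "emeasure M D = 0"
      then have "AE x in M. x \<notin> D" using AE_not_in[of D M] by (auto simp: null_sets_def)
      then have "AE x in M. x \<in> D \<longrightarrow> f x = 0" by eventually_elim auto
      then show False using null_sets_nu_iff[OF f D] CD Cpos by simp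
    qed
    \<comment> \<open>Not being an atom, \<open>D\<close> splits into two parts that are not null;
      the one with the smaller \<open>nu f\<close>-measure is kept.\<close>
    moreover have "\<not> is_atom M D" using atomfree CR DC by blast
    ultimately obtain B where B [measurable]: "B \<in> sets M" and BD: "B \<subseteq> D"
      and "emeasure M B \<noteq> 0" "emeasure M (D - B) \<noteq> 0"
      using is_atomI[OF D] by blast
    then have "measure (nu f) B \<noteq> 0" "measure (nu f) (D - B) \<noteq> 0"
      using null[of B] null[of "D - B"] by (auto simp: null_sets_def)
    then have p: "0 < measure (nu f) B" "0 < measure (nu f) (D - B)"
      by (simp_all add: zero_less_measure_iff)
    have "measure (nu f) (D - B) = measure (nu f) C - measure (nu f) B"
      using nu.finite_measure_Diff[of D B] BD CD by simp
    then consider "measure (nu f) B \<le> measure (nu f) C / 2" | "measure (nu f) (D - B) \<le> measure (nu f) C / 2"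
      by linarith
    then show ?thesis
    proof cases
      case 1
      then show ?thesis using p BD DC by (intro bexI[of _ B]) auto
    next
      case 2
      then show ?thesis using p DC by (intro bexI[of _ "D - B"]) auto
    qed
  qed
  have "\<exists>C\<in>sets M. C \<subseteq> R \<and> 0 < measure (nu f) C \<and> measure (nu f) C \<le> measure (nu f) R / 2 ^ n" for n
  proof (induction n)
    case 0
    then show ?case using pos R by (intro bexI[of _ R]) (auto simp: zero_less_measure_iff)
  next
    case (Suc n)
    then obtain C where C: "C \<in> sets M" "C \<subseteq> R" "0 < measure (nu f) C"
      "measure (nu f) C \<le> measure (nu f) R / 2 ^ n" by blast
    from split[OF C(1-3)] obtain B where B: "B \<in> sets M" "B \<subseteq> C" "0 < measure (nu f) B"
      "measure (nu f) B \<le> measure (nu f) C / 2" by blast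
    moreover have "measure (nu f) B \<le> measure (nu f) R / 2 ^ Suc n"
      using B(4) C(4) by simp
    ultimately show ?case using C(2) by (intro bexI[of _ B]) auto
  qed
  moreover obtain n where "measure (nu f) R / e < 2 ^ n"
    using real_arch_pow[of 2 "measure (nu f) R / e"] by auto
  then have "measure (nu f) R / 2 ^ n \<le> e"
    using \<open>0 < e\<close> by (simp add: field_simps)
  ultimately show ?thesis by (meson order_trans)
qed

end

section \<open>The set function \<open>B \<mapsto> U (restr f B)\<close>\<close>

context bounded_functional
begin

lemma U_restr_Un:
  assumes "f \<in> L" "B \<in> sets M" "C \<in> sets M" "B \<inter> C = {}"
  shows "U (restr f (B \<union> C)) = U (restr f B) + U (restr f C)"
proof -
  have "restr f (B \<union> C) = (\<lambda>x. restr f B x + restr f C x)"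
    using assms(4) by (auto simp: restr_def indicator_def fun_eq_iff)
  then show ?thesis using U_add restr_in_L assms by simp
qed

lemma U_restr_empty: "U (restr f {}) = 0"
  by (simp add: restr_def U_zero)

lemma U_restr_UN_lessThan:
  fixes B :: "nat \<Rightarrow> 'a set"
  assumes f: "f \<in> L" and B: "range B \<subseteq> sets M" "disjoint_family B"
  shows "U (restr f (\<Union>i<n. B i)) = (\<Sum>i<n. U (restr f (B i)))"
proof (induction n)
  case (Suc n)
  have "B i \<inter> B n = {}" if "i < n" for i
    using disjoint_family_onD[OF B(2), of i n] that by simp
  then have "(\<Union>i<n. B i) \<inter> B n = {}" by auto
  then have "U (restr f ((\<Union>i<n. B i) \<union> B n)) = U (restr f (\<Union>i<n. B i)) + U (restr f (B n))"
    using B(1) by (intro U_restr_Un[OF f]) auto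
  moreover have "(\<Union>i<Suc n. B i) = (\<Union>i<n. B i) \<union> B n"
    by (auto simp: lessThan_Suc)
  ultimately show ?case using Suc by simp
qed (simp add: U_restr_empty)

text \<open>\<open>U_little_o\<close> for the restrictions of one fixed \<open>f\<close>, with the
  modular rewritten as \<open>nu f\<close>.\<close>

lemma U_restr_le:
  assumes f: "f \<in> L" and "0 < c"
  obtains e where "0 < e"
    "\<And>B. B \<in> sets M \<Longrightarrow> measure (nu f) B \<le> e \<Longrightarrow> \<bar>U (restr f B)\<bar> \<le> c * measure (nu f) B"
proof -
  obtain e where "0 < e"
    and e: "\<And>g. g \<in> L \<Longrightarrow> modular g \<le> ennreal e \<Longrightarrow> \<bar>U g\<bar> \<le> c * enn2real (modular g)"
    using U_little_o[OF \<open>0 < c\<close>] by blast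
  have "\<bar>U (restr f B)\<bar> \<le> c * measure (nu f) B" if "B \<in> sets M" "measure (nu f) B \<le> e" for B
    using e[OF restr_in_L[OF f that(1)]] that(2) by (simp add: modular_restr[OF f that(1)] ennreal_leI)
  with \<open>0 < e\<close> show ?thesis using that by blast
qed

text \<open>With \<open>c = 1\<close>, sets of small \<open>nu f\<close>-measure satisfy
  \<open>\<bar>U (restr f B)\<bar> \<le> measure (nu f) B\<close>. Applied to the \<open>B n\<close>
  this gives absolute summability; applied to the tails \<open>T n\<close> it makes the remainder in
  the finite additivity formula vanish.\<close>

lemma U_restr_countably_additive:
  fixes B :: "nat \<Rightarrow> 'a set"
  assumes f: "f \<in> L" and B: "range B \<subseteq> sets M" "disjoint_family B"
  shows "summable (\<lambda>n. \<bar>U (restr f (B n))\<bar>)"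
    and "(\<lambda>n. U (restr f (B n))) sums U (restr f (\<Union>n. B n))"
proof -
  interpret nu: finite_measure "nu f" using f by (rule finite_measure_nu)
  obtain e where e: "0 < e"
    "\<And>B. B \<in> sets M \<Longrightarrow> measure (nu f) B \<le> e \<Longrightarrow> \<bar>U (restr f B)\<bar> \<le> 1 * measure (nu f) B"
    using U_restr_le[OF f zero_less_one] by blast
  have sums: "(\<lambda>n. measure (nu f) (B n)) sums measure (nu f) (\<Union>n. B n)"
    using B by (intro nu.finite_measure_UNION) auto
  then have "(\<lambda>n. measure (nu f) (B n)) \<longlonglongrightarrow> 0"
    using summable_LIMSEQ_zero sums_summable by blast
  then have "\<forall>\<^sub>F n in sequentially. measure (nu f) (B n) < e"
    using order_tendstoD(2) e(1) by blast
  then have "\<forall>\<^sub>F n in sequentially. norm \<bar>U (restr f (B n))\<bar> \<le> measure (nu f) (B n)"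
    by eventually_elim (use e(2) B(1) in force)
  then show "summable (\<lambda>n. \<bar>U (restr f (B n))\<bar>)"
    by (rule summable_comparison_test_ev[OF _ sums_summable[OF sums]])
  define T where "T n = (\<Union>i. B i) - (\<Union>i<n. B i)" for n
  have T_sets: "T n \<in> sets M" for n
    using B(1) by (auto simp: T_def)
  have T_split: "U (restr f (\<Union>i. B i)) = (\<Sum>i<n. U (restr f (B i))) + U (restr f (T n))" for n
  proof -
    have "(\<Union>i. B i) = (\<Union>i<n. B i) \<union> T n" by (auto simp: T_def)
    moreover have "U (restr f ((\<Union>i<n. B i) \<union> T n)) = U (restr f (\<Union>i<n. B i)) + U (restr f (T n))"
      using B(1) T_sets by (intro U_restr_Un[OF f]) (auto simp: T_def)
    ultimately show ?thesis using U_restr_UN_lessThan[OF f B] by simp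
  qed
  have T_meas: "measure (nu f) (T n) = measure (nu f) (\<Union>i. B i) - (\<Sum>i<n. measure (nu f) (B i))" for n
  proof -
    have "measure (nu f) (\<Union>i<n. B i) = (\<Sum>i<n. measure (nu f) (B i))"
      using B by (intro nu.finite_measure_finite_Union) (auto simp: disjoint_family_on_def)
    then show ?thesis
      unfolding T_def using B(1) by (subst nu.finite_measure_Diff) auto
  qed
  have "(\<lambda>n. measure (nu f) (T n)) \<longlonglongrightarrow> measure (nu f) (\<Union>i. B i) - measure (nu f) (\<Union>i. B i)"
    unfolding T_meas using sums by (intro tendsto_intros) (simp add: sums_def)
  then have T0: "(\<lambda>n. measure (nu f) (T n)) \<longlonglongrightarrow> 0" by simp
  have "\<forall>\<^sub>F n in sequentially. measure (nu f) (T n) < e"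
    using order_tendstoD(2)[OF T0] e(1) by blast
  then have "\<forall>\<^sub>F n in sequentially. norm (U (restr f (T n))) \<le> measure (nu f) (T n)"
    by eventually_elim (use e(2)[OF T_sets] in force)
  then have "(\<lambda>n. U (restr f (T n))) \<longlonglongrightarrow> 0"
    by (rule Lim_null_comparison[OF _ T0])
  then have "(\<lambda>n. U (restr f (\<Union>i. B i)) - U (restr f (T n))) \<longlonglongrightarrow> U (restr f (\<Union>i. B i)) - 0"
    by (intro tendsto_intros)
  moreover have "U (restr f (\<Union>i. B i)) - U (restr f (T n)) = (\<Sum>i<n. U (restr f (B i)))" for n
    using T_split[of n] by simp
  ultimately show "(\<lambda>n. U (restr f (B n))) sums U (restr f (\<Union>n. B n))"
    by (simp add: sums_def)
qed

text \<open>Exhaust \<open>R\<close> by disjoint sets of \<open>nu f\<close>-measure at most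
  \<open>e\<close>, on each of which \<open>U\<close> is at most \<open>c\<close> times that
  measure. What remains is null for \<open>nu f\<close>, since otherwise it would contain a further
  small set of positive measure. Summation gives \<open>c * measure (nu f) R\<close> with
  \<open>c\<close> arbitrary.\<close>

lemma U_restr_atomfree:
  assumes f: "f \<in> L" and R: "R \<in> sets M" and atomfree: "\<And>B. is_atom M B \<Longrightarrow> \<not> B \<subseteq> R"
  shows "U (restr f R) = 0"
proof -
  interpret nu: finite_measure "nu f" using f by (rule finite_measure_nu)
  have le: "\<bar>U (restr f R)\<bar> \<le> c * measure (nu f) R" if "0 < c" for c
  proof -
    obtain e where e: "0 < e"
      "\<And>B. B \<in> sets M \<Longrightarrow> measure (nu f) B \<le> e \<Longrightarrow> \<bar>U (restr f B)\<bar> \<le> c * measure (nu f) B"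
      using U_restr_le[OF f \<open>0 < c\<close>] by blast
    let ?P = "\<lambda>B. B \<in> sets (nu f) \<and> B \<subseteq> R \<and> measure (nu f) B \<le> e"
    have P: "?P {}" using e(1) by simp
    obtain B :: "nat \<Rightarrow> 'a set" where B: "\<And>n. ?P (B n)" "disjoint_family B"
      and max: "\<And>C. ?P C \<Longrightarrow> C \<inter> (\<Union>n. B n) = {} \<Longrightarrow> measure (nu f) C = 0"
      by (rule nu.exhaustion[of ?P, OF _ P]) blast+
    have B_sets: "range B \<subseteq> sets M" using B(1) by auto
    define T where "T = R - (\<Union>n. B n)"
    have T: "T \<in> sets M" using R B_sets by (auto simp: T_def)
    have T0: "measure (nu f) T = 0"
    proof (rule ccontr)
      assume "measure (nu f) T \<noteq> 0"
      moreover have "\<not> B \<subseteq> T" if "is_atom M B" for B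
        using atomfree[OF that] by (auto simp: T_def)
      ultimately obtain C where "C \<in> sets M" "C \<subseteq> T" "0 < measure (nu f) C" "measure (nu f) C \<le> e"
        using small_subset_of_atomfree[OF f T _ _ e(1)] by blast
      moreover from this have "measure (nu f) C = 0"
        by (intro max) (auto simp: T_def)
      ultimately show False by simp
    qed
    then have UT: "U (restr f T) = 0" using e(2)[OF T] e(1) by simp
    have "R = (\<Union>n. B n) \<union> T" using B(1) by (auto simp: T_def)
    moreover have "U (restr f ((\<Union>n. B n) \<union> T)) = U (restr f (\<Union>n. B n)) + U (restr f T)"
      using B_sets T by (intro U_restr_Un[OF f]) (auto simp: T_def)
    ultimately have UR: "U (restr f R) = U (restr f (\<Union>n. B n))" using UT by simp
    have sums: "(\<lambda>n. measure (nu f) (B n)) sums measure (nu f) (\<Union>n. B n)"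
      using B by (intro nu.finite_measure_UNION) auto
    note ca = U_restr_countably_additive[OF f B_sets B(2)]
    have "\<bar>U (restr f (\<Union>n. B n))\<bar> \<le> (\<Sum>n. \<bar>U (restr f (B n))\<bar>)"
      using summable_rabs[OF ca(1)] sums_unique[OF ca(2)] by simp
    also have "\<dots> \<le> (\<Sum>n. c * measure (nu f) (B n))"
      using B(1) e(2) by (intro suminf_le ca(1) summable_mult sums_summable[OF sums]) auto
    also have "\<dots> = c * measure (nu f) (\<Union>n. B n)"
      using suminf_mult[OF sums_summable[OF sums]] sums_unique[OF sums] by simp
    also have "\<dots> \<le> c * measure (nu f) R"
      using B(1) R \<open>0 < c\<close> by (intro mult_left_mono nu.finite_measure_mono) auto
    finally show ?thesis using UR by simp
  qed
  have "\<bar>U (restr f R)\<bar> \<le> 0"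
  proof (rule field_le_epsilon)
    fix e :: real assume "0 < e"
    \<comment> \<open>Adding 1 keeps the denominator positive when \<open>R\<close> is null for
      \<open>nu f\<close>.\<close>
    have p: "0 < measure (nu f) R + 1" using measure_nonneg[of "nu f" R] by linarith
    have "\<bar>U (restr f R)\<bar> \<le> e / (measure (nu f) R + 1) * measure (nu f) R"
      using le[of "e / (measure (nu f) R + 1)"] p \<open>0 < e\<close> by simp
    also have "\<dots> \<le> e" using p \<open>0 < e\<close> by (simp add: field_simps)
    finally show "\<bar>U (restr f R)\<bar> \<le> 0 + e" by simp
  qed
  then show ?thesis by simp
qed

end

subsection \<open>Expansion along the atoms\<close>

context Orlicz
begin

lemma is_atom_measure:
  assumes "is_atom M A"
  shows "0 < measure M A" "emeasure M A = ennreal (measure M A)"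
proof -
  show eq: "emeasure M A = ennreal (measure M A)"
    using is_atom_finite[OF assms] by (intro emeasure_eq_ennreal_measure) auto
  show "0 < measure M A"
    using is_atom_emeasure[OF assms] eq by (simp add: zero_less_measure_iff)
qed

lemma indicator_atom_in_L:
  assumes "is_atom M A"
  shows "(\<lambda>x. c * indicator A x) \<in> L"
  using is_atom_sets[OF assms] is_atom_measure(2)[OF assms] modular_const_indicator[of A c]
  by (simp add: L_iff ennreal_mult_less_top)

lemma restr_atom_AE:
  assumes "is_atom M A" "f \<in> L"
  shows "AE x in M. restr f A x = atom_value M f A * indicator A x"
  using AE_atom_value[OF assms(1) L_measurable[OF assms(2)]]
  by eventually_elim (auto simp: restr_def indicator_def)

text \<open>In the notation of the proof,
  \<open>\<Phi> c = t * \<Phi> z \<le> \<Phi> (t * z)\<close>, where \<open>t \<le> 1\<close> allows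
  \<open>Phi_ray\<close>.\<close>

lemma abs_atom_value_le:
  assumes A: "is_atom M A" and f: "f \<in> L" and t: "measure (nu f) A \<le> 1"
  shows "\<bar>atom_value M f A\<bar> \<le> measure (nu f) A * Phi_inv \<Phi> (1 / measure M A)"
proof -
  define a t c z where "a = measure M A" and "t = measure (nu f) A"
    and "c = atom_value M f A" and "z = Phi_inv \<Phi> (1 / a)"
  have a: "0 < a" using is_atom_measure[OF A] by (simp add: a_def)
  have z: "0 \<le> z" "\<Phi> z = 1 / a" using a Phi_inv[of "1 / a"] by (auto simp: z_def)
  have "ennreal t = ennreal (\<Phi> c * a)"
    using modular_restr[OF f is_atom_sets[OF A]] modular_cong_AE[OF restr_atom_AE[OF A f]]
      modular_const_indicator[OF is_atom_sets[OF A]] is_atom_measure[OF A]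
    by (simp add: t_def c_def a_def ennreal_mult)
  then have "\<Phi> c = t * (1 / a)"
    using a by (simp add: t_def field_simps)
  also have "\<dots> \<le> \<Phi> (t * z)"
    using Phi_ray[of t z] z assms(3) by (simp add: t_def)
  finally have "\<bar>c\<bar> \<le> \<bar>t * z\<bar>" by (rule Phi_le_D)
  then show ?thesis
    using z by (simp add: c_def t_def z_def a_def abs_mult)
qed

section \<open>Linearity and continuity of atomic sums with finite norm\<close>

lemma linear_functional_if_has_sum:
  assumes A: "\<And>i. i \<in> I \<Longrightarrow> is_atom M (A i)"
    and U: "\<And>f. f \<in> L \<Longrightarrow> ((\<lambda>i. u i * atom_value M f (A i)) has_sum U f) I"
  shows "linear_functional M \<Phi> U"
  unfolding linear_functional_def
proof safe
  fix f g :: "'a \<Rightarrow> real" and a b :: real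
  assume f: "f \<in> L" and g: "g \<in> L"
  have av: "atom_value M (\<lambda>x. a * f x + b * g x) (A i) = a * atom_value M f (A i) + b * atom_value M g (A i)"
    if "i \<in> I" for i
  proof (rule atom_value_eqI[OF A[OF that]])
    show "AE x in M. x \<in> A i \<longrightarrow>
        a * f x + b * g x = a * atom_value M f (A i) + b * atom_value M g (A i)"
      using AE_atom_value[OF A[OF that] L_measurable[OF f]] AE_atom_value[OF A[OF that] L_measurable[OF g]]
      by eventually_elim auto
  qed
  have "((\<lambda>i. a * (u i * atom_value M f (A i)) + b * (u i * atom_value M g (A i)))
      has_sum (a * U f + b * U g)) I"
    by (intro has_sum_add has_sum_cmult_right U f g)
  moreover have "((\<lambda>i. a * (u i * atom_value M f (A i)) + b * (u i * atom_value M g (A i)))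
      has_sum U (\<lambda>x. a * f x + b * g x)) I"
    using U[OF L_lincomb[OF f g, of a b]] av
    by (subst has_sum_cong[where g = "\<lambda>i. u i * atom_value M (\<lambda>x. a * f x + b * g x) (A i)"])
      (auto simp: algebra_simps)
  ultimately show "U (\<lambda>x. a * f x + b * g x) = a * U f + b * U g"
    using has_sum_unique by blast
qed

text \<open>Once \<open>g - f\<close> has quasi-norm below \<open>\<delta>\<close>, dividing it by
  \<open>\<delta>\<close> lands in the modular unit ball, where \<open>U\<close> is at most the norm
  \<open>K\<close>.\<close>

lemma continuous_functional_if_norm_finite:
  assumes lin: "linear_functional M \<Phi> U" and fin: "functional_norm M \<Phi> U < \<infinity>"
  shows "continuous_functional M \<Phi> U"
proof -
  define s where "s = functional_norm M \<Phi> U"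
  have le_s: "ereal \<bar>U g\<bar> \<le> s" if "g \<in> L" "modular g \<le> 1" for g
    unfolding s_def functional_norm_def using qnorm_le[of 1 g] that by (intro SUP_upper) auto
  have "0 \<le> s"
    using le_s[OF L_zero] by (intro order_trans[of 0 "ereal \<bar>U (\<lambda>_. 0)\<bar>" s]) (auto simp: modular_def)
  then obtain K where K: "s = ereal K" "0 \<le> K"
    using fin by (cases s) (auto simp: s_def)
  show ?thesis
    unfolding continuous_functional_def
  proof safe
    fix f :: "'a \<Rightarrow> real" and \<epsilon> :: real
    assume f: "f \<in> L" and "0 < \<epsilon>"
    \<comment> \<open>\<open>K + 1\<close> avoids division by 0 and makes
      \<open>K * \<delta> < \<epsilon>\<close> strict.\<close>
    define \<delta> where "\<delta> = \<epsilon> / (K + 1)"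
    have \<delta>: "0 < \<delta>" using \<open>0 < \<epsilon>\<close> K by (simp add: \<delta>_def)
    have "\<bar>U g - U f\<bar> < \<epsilon>" if g: "g \<in> L" and q: "Orlicz_qnorm M \<Phi> (\<lambda>x. g x - f x) < \<delta>" for g
    proof -
      have h: "(\<lambda>x. g x - f x) \<in> L" using g f by (rule L_diff)
      have "U (\<lambda>x. (g x - f x) / \<delta>) = (U g - U f) / \<delta>"
        using lin[unfolded linear_functional_def, rule_format, OF g f, of "1 / \<delta>" "- 1 / \<delta>"]
        by (simp add: diff_divide_distrib)
      moreover have "ereal \<bar>U (\<lambda>x. (g x - f x) / \<delta>)\<bar> \<le> s"
        using L_cmult[OF h, of "1 / \<delta>"] modular_le_1_if_qnorm_less[OF h q] by (intro le_s) simp_all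
      ultimately have "\<bar>U g - U f\<bar> / \<delta> \<le> K"
        using K \<delta> by (simp add: abs_divide)
      then have "\<bar>U g - U f\<bar> \<le> K * \<delta>"
        using \<delta> by (simp add: pos_divide_le_eq)
      also have "\<dots> < \<epsilon>"
        using K \<open>0 < \<epsilon>\<close> by (simp add: \<delta>_def field_simps)
      finally show ?thesis .
    qed
    with \<delta> show "\<exists>\<delta>>0. \<forall>g\<in>L. Orlicz_qnorm M \<Phi> (\<lambda>x. g x - f x) < \<delta> \<longrightarrow> \<bar>U g - U f\<bar> < \<epsilon>"
      by blast
  qed
qed

end

section \<open>Atomic expansion and norm of a bounded functional\<close>

context bounded_functional
begin

lemma U_eq_0_if_no_atoms:
  assumes "f \<in> L" "atoms M = {}"
  shows "U f = 0"
proof -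
  have "U f = U (restr f (space M))"
    using assms by (intro U_cong_AE restr_in_L) (auto simp: restr_def intro!: AE_I2)
  then show ?thesis using U_restr_atomfree[OF assms(1), of "space M"] assms(2) by (auto simp: atoms_def)
qed

text \<open>On an atom \<open>f\<close> is a.e. a multiple of the indicator, so the coefficient
  \<open>u\<close> of the expansion is \<open>U (indicator A)\<close>.\<close>

lemma U_restr_atom:
  assumes "is_atom M A" "f \<in> L"
  shows "U (restr f A) = U (indicator A) * atom_value M f A"
proof -
  have ind: "(indicator A :: 'a \<Rightarrow> real) \<in> L"
    using indicator_atom_in_L[OF assms(1), of 1] by simp
  have "U (restr f A) = U (\<lambda>x. atom_value M f A * indicator A x)"
    using assms is_atom_sets[OF assms(1)]
    by (intro U_cong_AE restr_in_L restr_atom_AE indicator_atom_in_L)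
  then show ?thesis by (simp add: U_cmult[OF ind])
qed

text \<open>These multiples of indicators are the test functions for the lower bound of the norm:
  the height \<open>Phi_inv \<Phi> (1 / measure M A)\<close> gives modular 1.\<close>

lemma U_normalized_indicator:
  assumes "is_atom M A"
  shows "\<bar>U (indicator A)\<bar> * Phi_inv \<Phi> (1 / measure M A) = \<bar>U (\<lambda>x. Phi_inv \<Phi> (1 / measure M A) * indicator A x)\<bar>"
    and "modular (\<lambda>x. Phi_inv \<Phi> (1 / measure M A) * indicator A x) \<le> 1"
proof -
  have ind: "(indicator A :: 'a \<Rightarrow> real) \<in> L"
    using indicator_atom_in_L[OF assms(1), of 1] by simp
  have a: "0 < measure M A" "emeasure M A = ennreal (measure M A)"
    using is_atom_measure[OF assms] by auto
  show "\<bar>U (indicator A)\<bar> * Phi_inv \<Phi> (1 / measure M A) = \<bar>U (\<lambda>x. Phi_inv \<Phi> (1 / measure M A) * indicator A x)\<bar>"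
    using Phi_inv_nonneg[of "1 / measure M A"] by (simp add: U_cmult[OF ind] abs_mult)
  have "modular (\<lambda>x. Phi_inv \<Phi> (1 / measure M A) * indicator A x)
      = ennreal (1 / measure M A) * ennreal (measure M A)"
    using a(2) Phi_Phi_inv[of "1 / measure M A"] modular_const_indicator[OF is_atom_sets[OF assms]] by simp
  also have "\<dots> = 1" using a(1) by (simp flip: ennreal_mult)
  finally show "modular (\<lambda>x. Phi_inv \<Phi> (1 / measure M A) * indicator A x) \<le> 1" by simp
qed

text \<open>The atoms form a sequence padded with empty sets, so that countable additivity applies
  to it directly; \<open>I\<close> holds the genuine indices.\<close>

context
  fixes A :: "nat \<Rightarrow> 'a set" and I :: "nat set"
  defines "I \<equiv> {n. A n \<noteq> {}}"
  assumes atom: "\<And>i. i \<in> I \<Longrightarrow> is_atom M (A i)"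
    and A_sets: "range A \<subseteq> sets M" and A_disj: "disjoint_family A"
    and exhaust: "\<And>B. is_atom M B \<Longrightarrow> \<not> B \<subseteq> - (\<Union>n. A n)"
begin

lemma U_sums_restr_atoms:
  assumes f: "f \<in> L"
  shows "(\<lambda>n. U (restr f (A n))) sums U f"
proof -
  let ?R = "space M - (\<Union>n. A n)"
  have R: "?R \<in> sets M" using A_sets by auto
  have "U (restr f ?R) = 0"
    using exhaust by (intro U_restr_atomfree[OF f R]) blast
  moreover have "U (restr f ((\<Union>n. A n) \<union> ?R)) = U (restr f (\<Union>n. A n)) + U (restr f ?R)"
    using A_sets R by (intro U_restr_Un[OF f]) auto
  moreover have "U f = U (restr f ((\<Union>n. A n) \<union> ?R))"
    using A_sets R f by (intro U_cong_AE restr_in_L) (auto simp: restr_def indicator_def intro!: AE_I2)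
  ultimately show ?thesis
    using U_restr_countably_additive(2)[OF f A_sets A_disj] by simp
qed

text \<open>Absolute summability turns the series into an unordered sum; the empty sets contribute
  0, so \<open>UNIV\<close> shrinks to \<open>I\<close>.\<close>

lemma U_has_sum_atoms:
  assumes f: "f \<in> L"
  shows "((\<lambda>i. U (indicator (A i)) * atom_value M f (A i)) has_sum U f) I"
proof -
  have "((\<lambda>n. U (restr f (A n))) has_sum U f) UNIV"
    using U_restr_countably_additive(1)[OF f A_sets A_disj] U_sums_restr_atoms[OF f]
    by (intro norm_summable_imp_has_sum) auto
  moreover have "((\<lambda>n. U (restr f (A n))) has_sum U f) UNIV \<longleftrightarrow>
      ((\<lambda>i. U (indicator (A i)) * atom_value M f (A i)) has_sum U f) I"
    using U_restr_atom[OF atom f] by (intro has_sum_cong_neutral) (auto simp: I_def U_restr_empty)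
  ultimately show ?thesis by blast
qed

text \<open>By \<open>abs_atom_value_le\<close> each atom contributes at most
  \<open>S * measure (nu f) (A n)\<close>, and the total \<open>nu f\<close>-measure is at most
  1.\<close>

lemma abs_U_le_if_coeff_le:
  assumes f: "f \<in> L" "modular f \<le> 1"
    and S: "\<And>i. i \<in> I \<Longrightarrow> \<bar>U (indicator (A i))\<bar> * Phi_inv \<Phi> (1 / measure M (A i)) \<le> S" and "0 \<le> S"
  shows "\<bar>U f\<bar> \<le> S"
proof -
  interpret nu: finite_measure "nu f" using f(1) by (rule finite_measure_nu)
  have le1: "measure (nu f) B \<le> 1" if "B \<in> sets M" for B
  proof -
    have "ennreal (measure (nu f) B) \<le> modular f"
      unfolding modular_restr[OF f(1) that, symmetric] restr_def
      by (intro modular_mono) (auto simp: indicator_def)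
    then show ?thesis using f(2) order_trans by fastforce
  qed
  have le: "\<bar>U (restr f (A n))\<bar> \<le> S * measure (nu f) (A n)" for n
  proof (cases "n \<in> I")
    case True
    let ?z = "Phi_inv \<Phi> (1 / measure M (A n))"
    have "\<bar>U (restr f (A n))\<bar> = \<bar>U (indicator (A n))\<bar> * \<bar>atom_value M f (A n)\<bar>"
      by (simp add: U_restr_atom[OF atom[OF True] f(1)] abs_mult)
    also have "\<dots> \<le> \<bar>U (indicator (A n))\<bar> * (measure (nu f) (A n) * ?z)"
      using A_sets by (intro mult_left_mono abs_atom_value_le atom True f(1) le1) auto
    also have "\<dots> = (\<bar>U (indicator (A n))\<bar> * ?z) * measure (nu f) (A n)" by simp
    also have "\<dots> \<le> S * measure (nu f) (A n)" using S[OF True] by (intro mult_right_mono) auto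
    finally show ?thesis .
  next
    case False
    then show ?thesis by (simp add: I_def U_restr_empty)
  qed
  have sums: "(\<lambda>n. measure (nu f) (A n)) sums measure (nu f) (\<Union>n. A n)"
    using A_sets A_disj by (intro nu.finite_measure_UNION) auto
  note abs_summable = U_restr_countably_additive(1)[OF f(1) A_sets A_disj]
  have "\<bar>U f\<bar> \<le> (\<Sum>n. \<bar>U (restr f (A n))\<bar>)"
    using summable_rabs[OF abs_summable] sums_unique[OF U_sums_restr_atoms[OF f(1)]] by simp
  also have "\<dots> \<le> (\<Sum>n. S * measure (nu f) (A n))"
    by (intro suminf_le le abs_summable summable_mult sums_summable[OF sums])
  also have "\<dots> = S * measure (nu f) (\<Union>n. A n)"
    using suminf_mult[OF sums_summable[OF sums]] sums_unique[OF sums] by simp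
  also have "\<dots> \<le> S" using le1[of "\<Union>n. A n"] A_sets \<open>0 \<le> S\<close> by (intro mult_left_le) auto
  finally show ?thesis .
qed

lemma functional_norm_eq_SUP:
  assumes "I \<noteq> {}"
  defines "N \<equiv> SUP i\<in>I. ereal (\<bar>U (indicator (A i))\<bar> * Phi_inv \<Phi> (1 / measure M (A i)))"
  shows "functional_norm M \<Phi> U = N" "N < \<infinity>"
proof -
  let ?v = "\<lambda>i. \<bar>U (indicator (A i))\<bar> * Phi_inv \<Phi> (1 / measure M (A i))"
  have v_le_N: "ereal (?v i) \<le> N" if "i \<in> I" for i
    unfolding N_def using that by (rule SUP_upper)
  have v_nonneg: "0 \<le> ?v i" for i
    using Phi_inv_nonneg[of "1 / measure M (A i)"] by simp
  have "?v i \<le> K" if "i \<in> I" for i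
    unfolding U_normalized_indicator(1)[OF atom[OF that]]
    by (intro bound indicator_atom_in_L U_normalized_indicator(2) atom that)
  then have "N \<le> ereal K" unfolding N_def by (intro SUP_least) simp
  then show "N < \<infinity>" by (auto intro: le_less_trans)
  \<comment> \<open>An index is needed for \<open>0 \<le> N\<close>: a supremum over no indices
    would be minus infinity in \<open>ereal\<close>.\<close>
  obtain i where "i \<in> I" using assms(1) by blast
  have "0 \<le> N"
    using v_le_N[OF \<open>i \<in> I\<close>] v_nonneg[of i] order_trans[of 0 "ereal (?v i)" N] by simp
  with \<open>N < \<infinity>\<close> obtain S where S: "N = ereal S" "0 \<le> S" by (cases N) auto
  have ball: "\<bar>U f\<bar> \<le> S" if "f \<in> L" "modular f \<le> 1" for f
    using that v_le_N S by (intro abs_U_le_if_coeff_le) auto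
  have "\<bar>U f\<bar> \<le> S" if f: "f \<in> L" and q: "Orlicz_qnorm M \<Phi> f \<le> 1" for f
  proof -
    \<comment> \<open>Quasi-norm at most 1 puts \<open>f / r\<close> in the modular ball for each
      \<open>r > 1\<close>; then \<open>r\<close> tends to 1 from the right.\<close>
    have "\<bar>U f\<bar> \<le> S * r" if "1 < r" for r
    proof -
      have "modular (\<lambda>x. 1 / r * f x) \<le> 1"
        using modular_le_1_if_qnorm_less(2)[OF f, of r] q that by simp
      then have "\<bar>U (\<lambda>x. 1 / r * f x)\<bar> \<le> S" by (intro ball L_cmult f)
      moreover have "U (\<lambda>x. 1 / r * f x) = 1 / r * U f" by (rule U_cmult[OF f])
      ultimately have "\<bar>U f\<bar> / r \<le> S" using that by (simp add: abs_mult)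
      then show ?thesis using that by (simp add: pos_divide_le_eq)
    qed
    then have "\<forall>\<^sub>F r in at_right 1. \<bar>U f\<bar> \<le> S * r"
      by (auto simp: eventually_at_right_field intro: exI[of _ 2])
    moreover have "((\<lambda>r. S * r) \<longlongrightarrow> S * 1) (at_right 1)" by (intro tendsto_intros)
    ultimately show ?thesis using tendsto_lowerbound by force
  qed
  then have "functional_norm M \<Phi> U \<le> N"
    unfolding functional_norm_def S by (intro SUP_least) auto
  moreover have "N \<le> functional_norm M \<Phi> U"
    unfolding N_def functional_norm_def
  proof (rule SUP_mono)
    fix i assume "i \<in> I"
    note at = atom[OF this]
    let ?g = "\<lambda>x. Phi_inv \<Phi> (1 / measure M (A i)) * indicator (A i) x"
    have "?g \<in> {f \<in> L. Orlicz_qnorm M \<Phi> f \<le> 1}"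
      using indicator_atom_in_L[OF at] U_normalized_indicator(2)[OF at] qnorm_le[of 1 ?g] by simp
    then show "\<exists>f\<in>{f \<in> L. Orlicz_qnorm M \<Phi> f \<le> 1}. ereal (?v i) \<le> ereal \<bar>U f\<bar>"
      using U_normalized_indicator(1)[OF at] by (intro bexI[of _ ?g]) auto
  qed
  ultimately show "functional_norm M \<Phi> U = N" by (rule antisym)
qed

end

end

section \<open>The characterization of continuous linear functionals\<close>

theorem mainTheorem16:
  fixes M :: "'a measure" and \<Phi> :: "real \<Rightarrow> real" and U :: "('a \<Rightarrow> real) \<Rightarrow> real"
  assumes "sigma_finite_measure M"
    and "Nstar_fun \<Phi>"
    and "\<exists>k\<ge>2. \<forall>x>0. \<Phi> (k * x) = 2 * \<Phi> x"
    and "respects_ae M \<Phi> U"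
  shows "(linear_functional M \<Phi> U \<and> continuous_functional M \<Phi> U) \<longleftrightarrow>
    ((atoms M = {} \<and> (\<forall>f \<in> Orlicz_space M \<Phi>. U f = 0)) \<or>
     (atoms M \<noteq> {} \<and>
      (\<exists>I A u. atom_enumeration M I A \<and>
        (\<forall>f \<in> Orlicz_space M \<Phi>. ((\<lambda>i. u i * atom_value M f (A i)) has_sum U f) I) \<and>
        functional_norm M \<Phi> U = (SUP i\<in>I. ereal (\<bar>u i\<bar> * Phi_inv \<Phi> (1 / measure M (A i)))) \<and>
        (SUP i\<in>I. ereal (\<bar>u i\<bar> * Phi_inv \<Phi> (1 / measure M (A i)))) < \<infinity>)))"
    (is "?lhs \<longleftrightarrow> ?a \<or> ?b")
proof -
  obtain k where k: "2 \<le> k" "\<And>x. 0 < x \<Longrightarrow> \<Phi> (k * x) = 2 * \<Phi> x"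
    using assms(3) by blast
  interpret Orlicz M \<Phi> k
    using assms(1) Nstar_fun_concave_Phi[OF assms(2) k] by (rule Orlicz.intro)
  show ?thesis
  proof (intro iffI)
    assume lhs: ?lhs
    then obtain K where "\<And>g. g \<in> L \<Longrightarrow> modular g \<le> 1 \<Longrightarrow> \<bar>U g\<bar> \<le> K"
      using continuous_bounded by blast
    with assms(4) lhs interpret bounded_functional M \<Phi> k U K
      by unfold_locales auto
    show "?a \<or> ?b"
    proof (cases "atoms M = {}")
      case True
      then show ?thesis using U_eq_0_if_no_atoms by blast
    next
      case False
      obtain A :: "nat \<Rightarrow> 'a set" where A: "atom_enumeration M {n. A n \<noteq> {}} A"
        "range A \<subseteq> sets M" "disjoint_family A" "\<And>B. is_atom M B \<Longrightarrow> \<not> B \<subseteq> - (\<Union>n. A n)"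
        using atom_enumeration_exists by blast
      have atom: "\<And>i. i \<in> {n. A n \<noteq> {}} \<Longrightarrow> is_atom M (A i)"
        using A(1) unfolding atom_enumeration_def by blast
      \<comment> \<open>Any atom of \<open>M\<close> is matched with an index of the
        enumeration.\<close>
      have "{n. A n \<noteq> {}} \<noteq> {}"
        using A(1) False unfolding atom_enumeration_def atoms_def by blast
      from functional_norm_eq_SUP[OF atom A(2-4) this] U_has_sum_atoms[OF atom A(2-4)] A(1) False
      show ?thesis
        by (intro disjI2 conjI exI[of _ "{n. A n \<noteq> {}}"] exI[of _ A] exI[of _ "\<lambda>i. U (indicator (A i))"] ballI)
    qed
  next
    assume "?a \<or> ?b"
    then show ?lhs
    proof
      assume a: ?a
      then have "linear_functional M \<Phi> U"
        unfolding linear_functional_def by (simp add: L_lincomb)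
      moreover have "continuous_functional M \<Phi> U"
        unfolding continuous_functional_def using a by (auto intro: exI[of _ 1])
      ultimately show ?lhs by blast
    next
      assume ?b
      then obtain I A u where A: "atom_enumeration M I A"
        and U: "\<forall>f\<in>L. ((\<lambda>i. u i * atom_value M f (A i)) has_sum U f) I"
        and norm: "functional_norm M \<Phi> U = (SUP i\<in>I. ereal (\<bar>u i\<bar> * Phi_inv \<Phi> (1 / measure M (A i))))"
          "(SUP i\<in>I. ereal (\<bar>u i\<bar> * Phi_inv \<Phi> (1 / measure M (A i)))) < \<infinity>"
        by blast
      have fin: "functional_norm M \<Phi> U < \<infinity>" using norm by simp
      have "linear_functional M \<Phi> U"
        using A U by (intro linear_functional_if_has_sum[of I A u]) (auto simp: atom_enumeration_def)
      with fin show ?lhs using continuous_functional_if_norm_finite by blast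
    qed
  qed
qed

end
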